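(* (i) Let $x$ be a non-zero real number. There is no planar non-collinear central configuration with multiplier $\xi=0$ for four bodies with masses $(m_1,m_2,m_3,m_4)=(x,-x,x,-x)$. (ii) Let $x$ and $y$ be two distinct non-zero real numbers. There exists exactly one (up to similarities) planar non-collinear central configuration $(\vec r_1,\vec r_2,\vec r_3,\vec r_4)$ with multiplier $\xi=0$ for four bodies with masses $(m_1,m_2,m_3,m_4)=(x,-x,y,-y)$. It is a parallelogram. The bodies with masses $x$ and $-x$ are at the endpoints of one diagonal, and the bodies with masses $y$ and $-y$ are at the endpoints of the other diagonal. The bodies whose masses have the smaller absolute value are at the endpoints of the larger diagonal. The two parallel sides whose endpoints have masses with the same sign are the largest ones (that is, longer than the two other sides).
   Context: Consider $N$ point bodies with non-zero real masses $m_1,\dots,m_N$ (positive or negative) at pairwise distinct positions $\vec r_1,\dots,\vec r_N$ in a Euclidean vector space. Define the accelerations $$\vec\gamma_i=\sum_{j\ne i} m_j\frac{\vec r_j-\vec r_i}{\|\vec r_j-\vec r_i\|^3}.$$ The configuration is called central with multiplier $\xi\in\mathbb{R}$ if $\vec\gamma_j-\vec\gamma_i=\xi(\vec r_j-\vec r_i)$ for all $i,j$. It is planar non-collinear if its points lie in a plane (identified with $\mathbb{R}^2$) but not on a line. Bodies are labelled: two configurations in $\mathbb{R}^2$ are the same up to similarities if some similarity of the plane (a composition of a translation, a rotation or reflection, and a homothety with non-zero ratio; orientation reversal is allowed) maps $\vec r_i$ to $\vec r_i'$ for every $i$.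
   Formalization: Part (ii) is stated with the additional condition y ≠ -x, because for y = -x exchanging the labels of bodies 3 and 4 gives masses (x,-x,x,-x), for which part (i) shows that no such configuration exists. *)

theory Defs
  imports "HOL-Analysis.Analysis"
begin

text \<open>
  A system of N bodies is a pair of lists of length N: masses and positions.
  List indices start at 0, so body number i in the usual labelling has index i - 1.
\<close>

definition acceleration :: "real list \<Rightarrow> 'a::euclidean_space list \<Rightarrow> nat \<Rightarrow> 'a" where
  "acceleration ms rs i =
     (\<Sum>j\<in>{..<length ms} - {i}. (ms ! j / norm (rs ! j - rs ! i) ^ 3) *\<^sub>R (rs ! j - rs ! i))"

definition central_configuration :: "real \<Rightarrow> real list \<Rightarrow> 'a::euclidean_space list \<Rightarrow> bool" where
  "central_configuration \<xi> ms rs \<longleftrightarrow>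
     length rs = length ms \<and> (\<forall>m\<in>set ms. m \<noteq> 0) \<and> distinct rs \<and>
     (\<forall>i<length ms. \<forall>j<length ms.
        acceleration ms rs j - acceleration ms rs i = \<xi> *\<^sub>R (rs ! j - rs ! i))"

definition planar_noncollinear_cc :: "real \<Rightarrow> real list \<Rightarrow> (real^2) list \<Rightarrow> bool" where
  "planar_noncollinear_cc \<xi> ms rs \<longleftrightarrow> central_configuration \<xi> ms rs \<and> \<not> collinear (set rs)"

text \<open>
  The orthogonal transformations of the plane are exactly the rotations about the origin
  and the reflections in lines through the origin.
\<close>

definition plane_similarity :: "(real^2 \<Rightarrow> real^2) \<Rightarrow> bool" where
  "plane_similarity f \<longleftrightarrow>
     (\<exists>T k a. orthogonal_transformation T \<and> k \<noteq> 0 \<and> f = (\<lambda>v. k *\<^sub>R T v + a))"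

definition same_up_to_similarity :: "(real^2) list \<Rightarrow> (real^2) list \<Rightarrow> bool" where
  "same_up_to_similarity rs rs' \<longleftrightarrow> (\<exists>f. plane_similarity f \<and> rs' = map f rs)"

text \<open>
  Non-degenerate parallelogram with vertices A, B, C, D in cyclic order: the sides are
  AB, BC, CD, DA and the diagonals are AC, BD.
\<close>

definition parallelogram :: "real^2 \<Rightarrow> real^2 \<Rightarrow> real^2 \<Rightarrow> real^2 \<Rightarrow> bool" where
  "parallelogram A B C D \<longleftrightarrow> B - A = C - D \<and> \<not> collinear {A, B, C, D}"

end

theory Submission
  imports Defs
begin

text \<open>
  Write \<open>V z = z / |z|^3\<close>. Bodies 1 and 2 carry opposite masses, so each of them gives the
  other the same acceleration. Equality of their accelerations therefore only involves bodies 3 and 4, and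
  after division by the mass \<open>y\<close> it no longer contains any mass:
  \<open>V (r3 - r1) + V (r4 - r2) = V (r4 - r1) + V (r3 - r2)\<close>, where the arguments on both sides have
  the same sum \<open>2 p\<close>. With \<open>r3 - r1 = p + u\<close> and \<open>r4 - r1 = p + v\<close> this reads \<open>f u = f v\<close>
  for \<open>f u = V (p + u) + V (p - u)\<close>.

  The heart of the proof is that for \<open>p \<noteq> 0\<close> the map \<open>f\<close> is injective up to the sign of its argument,
  apart from pairs of arguments on the line through \<open>p\<close> (\<open>pair_field_eq_imp\<close>). Scale to \<open>p = 1\<close> in the
  complex plane. On the open first quadrant the Jacobian determinant of \<open>f\<close> is
  \<open>- 2 (\<alpha> - \<beta>)^2 - 9 \<alpha> \<beta> sin^2 \<theta> < 0\<close>, where \<open>\<alpha>, \<beta>\<close> are the inverse cubes of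
  the lengths of \<open>1 + u\<close> and \<open>1 - u\<close> and \<open>\<theta>\<close> is the angle between them, so \<open>f\<close> is locally
  injective there. It maps the quadrant properly into the open lower half plane. For such a map the set of values
  attained at least twice is open and closed in the half plane, hence empty or everything;
  and \<open>-i\<close> is not attained twice. As \<open>u = \<plusminus> v\<close> would make two bodies coincide and the
  exceptional pairs are collinear configurations, only \<open>p = 0\<close> remains: the configuration is a parallelogram
  in which each pair of opposite masses spans a diagonal (\<open>zero_cc_is_parallelogram\<close>).

  For a parallelogram the remaining equations are linear in the inverse cubes of the two diagonals and the two
  sides. They say that these four numbers are proportional to \<open>1 - k e\<close>, \<open>1 - e / k\<close>,
  \<open>1 - e\<close>, \<open>1 + e\<close>, where \<open>k = y / x\<close> and \<open>e\<close> is unknown. The parallelogram law becomes one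
  equation \<open>length_defect k e = 0\<close>. Its roots have the sign of \<open>k\<close>, and on that side the function is
  strictly monotone by an arithmetic-geometric mean estimate; so there is one root if \<open>|k| \<noteq> 1\<close>
  and none if \<open>k = 1\<close>. Existence, uniqueness and all comparisons of lengths are read off from this root
  and its sign.
\<close>

section \<open>The attraction vector and the field of a pair\<close>

definition attraction :: "'a::real_inner \<Rightarrow> 'a" where "attraction z = (1 / norm z ^ 3) *\<^sub>R z"

lemma attraction_has_derivative:
  fixes z :: "'a::real_inner"
  assumes "z \<noteq> 0"
  shows "(attraction has_derivative (\<lambda>h. (1 / norm z ^ 3) *\<^sub>R h - (3 * (z \<bullet> h) / norm z ^ 5) *\<^sub>R z)) (at z)"
proof -
  have n: "(norm has_derivative (\<lambda>h. h \<bullet> sgn z)) (at z)"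
    using assms by (rule has_derivative_norm)
  have i: "((\<lambda>z. inverse (norm z ^ 3)) has_derivative
      (\<lambda>h. - (inverse (norm z ^ 3) * (of_nat 3 * (h \<bullet> sgn z) * norm z ^ (3 - 1)) * inverse (norm z ^ 3)))) (at z)"
    using assms by (intro Deriv.has_derivative_inverse has_derivative_power n) simp
  have "((\<lambda>z. inverse (norm z ^ 3) *\<^sub>R z) has_derivative (\<lambda>h. inverse (norm z ^ 3) *\<^sub>R h +
      (- (inverse (norm z ^ 3) * (of_nat 3 * (h \<bullet> sgn z) * norm z ^ (3 - 1)) * inverse (norm z ^ 3))) *\<^sub>R z)) (at z)"
    by (rule has_derivative_scaleR[OF i has_derivative_ident])
  moreover have "inverse (norm z ^ 3) * (of_nat 3 * (h \<bullet> sgn z) * norm z ^ (3 - 1)) * inverse (norm z ^ 3)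
    = 3 * (z \<bullet> h) / norm z ^ 5" for h
  proof -
    have "h \<bullet> sgn z = (z \<bullet> h) / norm z"
      by (simp add: sgn_div_norm inner_commute divide_inverse mult.commute)
    then show ?thesis using assms by (simp add: field_simps eval_nat_numeral)
  qed
  moreover have "(\<lambda>z::'a. inverse (norm z ^ 3) *\<^sub>R z) = attraction"
    by (rule ext) (simp add: attraction_def inverse_eq_divide)
  ultimately show ?thesis
    by (simp add: inverse_eq_divide)
qed

text \<open>
  This is the acceleration field of a mass \<open>1\<close> at the point \<open>1\<close> and a mass \<open>-1\<close> at the point \<open>-1\<close>.
\<close>

definition pair_field :: "complex \<Rightarrow> complex" where "pair_field w = attraction (1 + w) + attraction (1 - w)"

lemma attraction_minus: "attraction (- z) = - attraction z" by (simp add: attraction_def)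

lemma pair_field_minus: "pair_field (- w) = pair_field w" by (simp add: pair_field_def)

lemma Re_pair_field: "Re (pair_field w) = (1 + Re w) / cmod (1 + w) ^ 3 + (1 - Re w) / cmod (1 - w) ^ 3"
  and Im_pair_field: "Im (pair_field w) = Im w * (1 / cmod (1 + w) ^ 3 - 1 / cmod (1 - w) ^ 3)"
  by (simp_all add: pair_field_def attraction_def right_diff_distrib diff_divide_distrib)

text \<open>
  The entries of the symmetric Jacobian matrix of \<open>attraction\<close> on the complex plane.
\<close>

definition attraction_xx :: "complex \<Rightarrow> real" where "attraction_xx z = 1 / cmod z ^ 3 - 3 * (Re z)\<^sup>2 / cmod z ^ 5"
definition attraction_xy :: "complex \<Rightarrow> real" where "attraction_xy z = - 3 * (Re z * Im z) / cmod z ^ 5"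
definition attraction_yy :: "complex \<Rightarrow> real" where "attraction_yy z = 1 / cmod z ^ 3 - 3 * (Im z)\<^sup>2 / cmod z ^ 5"

lemma attraction_derivative_matrix:
  "(1 / cmod z ^ 3) *\<^sub>R h - (3 * (z \<bullet> h) / cmod z ^ 5) *\<^sub>R z =
    Complex (attraction_xx z * Re h + attraction_xy z * Im h) (attraction_xy z * Re h + attraction_yy z * Im h)"
 by (simp add: complex_eq_iff attraction_xx_def attraction_xy_def attraction_yy_def inner_complex_def divide_inverse
         algebra_simps power2_eq_square)

lemmas attraction_has_derivative_complex = attraction_has_derivative[where 'a = complex, unfolded attraction_derivative_matrix]

definition quadrant :: "complex set" where "quadrant = {w. 0 < Re w \<and> 0 < Im w}"

lemma quadrant_avoids_unit: assumes "w \<in> quadrant" shows "1 + w \<noteq> 0" "1 - w \<noteq> 0"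
  using assms by (auto simp: quadrant_def complex_eq_iff)

definition pair_field_jacobian :: "complex \<Rightarrow> complex \<Rightarrow> complex" where
  "pair_field_jacobian w h = Complex ((attraction_xx (1+w) - attraction_xx (1-w)) * Re h + (attraction_xy (1+w) - attraction_xy (1-w)) * Im h)
                   ((attraction_xy (1+w) - attraction_xy (1-w)) * Re h + (attraction_yy (1+w) - attraction_yy (1-w)) * Im h)"

lemma pair_field_has_derivative:
  assumes "1 + w \<noteq> 0" "1 - w \<noteq> 0"
  shows "(pair_field has_derivative pair_field_jacobian w) (at w)"
proof -
  have p: "((\<lambda>w. 1 + w) has_derivative (\<lambda>h. h)) (at w)" by (auto intro!: derivative_eq_intros)
  have m: "((\<lambda>w. 1 - w) has_derivative (\<lambda>h. - h)) (at w)" by (auto intro!: derivative_eq_intros)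
  let ?D = "\<lambda>z h. Complex (attraction_xx z * Re h + attraction_xy z * Im h) (attraction_xy z * Re h + attraction_yy z * Im h)"
  have 1: "((\<lambda>w. attraction (1 + w)) has_derivative (\<lambda>h. ?D (1 + w) h)) (at w)"
    by (rule has_derivative_compose[OF p attraction_has_derivative_complex[OF assms(1)]])
  have 2: "((\<lambda>w. attraction (1 - w)) has_derivative (\<lambda>h. ?D (1 - w) (- h))) (at w)"
    by (rule has_derivative_compose[OF m attraction_has_derivative_complex[OF assms(2)]])
  have pair_field_jacobian: "pair_field_jacobian w = (\<lambda>h. ?D (1 + w) h + ?D (1 - w) (- h))"
    by (rule ext, rule complex_eqI) (simp_all add: pair_field_jacobian_def algebra_simps)
  have "pair_field = (\<lambda>w. attraction (1 + w) + attraction (1 - w))" by (rule ext) (rule pair_field_def)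
  then show ?thesis
    unfolding pair_field_jacobian using has_derivative_add[OF 1 2] by (simp only:)
qed

section \<open>Local injectivity\<close>

text \<open>
  The Jacobian of \<open>attraction\<close> at \<open>z\<close> is \<open>I - 3 n n^T\<close> divided by \<open>|z|^3\<close>, with \<open>n\<close> the unit
  vector of \<open>z\<close>. Its trace is negative and it is indefinite; the identity shows that this
  indefiniteness survives when two such matrices, for the unit vectors \<open>(a, b)\<close> and \<open>(c, d)\<close>, are subtracted.
\<close>

lemma difference_determinant_identity:
  fixes a b c d \<alpha> \<beta> :: real
  assumes "a\<^sup>2 + b\<^sup>2 = 1" "c\<^sup>2 + d\<^sup>2 = 1"
  shows "(\<alpha> * (1 - 3 * a\<^sup>2) - \<beta> * (1 - 3 * c\<^sup>2)) * (\<alpha> * (1 - 3 * b\<^sup>2) - \<beta> * (1 - 3 * d\<^sup>2))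
    - (3 * (\<alpha> * (a * b) - \<beta> * (c * d)))\<^sup>2 = - 2 * (\<alpha> - \<beta>)\<^sup>2 - 9 * \<alpha> * \<beta> * (a * d - b * c)\<^sup>2"
  using assms by algebra

lemma pair_field_jacobian_det_neg:
  assumes "w \<in> quadrant"
  shows "(attraction_xx (1+w) - attraction_xx (1-w)) * (attraction_yy (1+w) - attraction_yy (1-w)) - (attraction_xy (1+w) - attraction_xy (1-w))\<^sup>2 < 0"
proof -
  define r1 r2 where "r1 = cmod (1+w)" and "r2 = cmod (1-w)"
  define a b c d where "a = Re (1+w) / r1" and "b = Im (1+w) / r1" and "c = Re (1-w) / r2" and "d = Im (1-w) / r2"
  have r: "r1 > 0" "r2 > 0" using quadrant_avoids_unit[OF assms] by (auto simp: r1_def r2_def)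
  have sq: "(Re z / cmod z)\<^sup>2 + (Im z / cmod z)\<^sup>2 = 1" if "z \<noteq> 0" for z
  proof -
    have "(Re z / cmod z)\<^sup>2 + (Im z / cmod z)\<^sup>2 = (cmod z)\<^sup>2 / (cmod z)\<^sup>2"
      by (simp only: cmod_power2 power_divide add_divide_distrib)
    then show ?thesis using that by simp
  qed
  have "a\<^sup>2 + b\<^sup>2 = 1" "c\<^sup>2 + d\<^sup>2 = 1"
    unfolding a_def b_def c_def d_def r1_def r2_def by (rule sq, rule quadrant_avoids_unit[OF assms])+
  note id = difference_determinant_identity[OF this, of "1/r1^3" "1/r2^3"]
  have e: "attraction_xx z = (1 / cmod z^3) * (1 - 3 * (Re z / cmod z)\<^sup>2)" "attraction_yy z = (1 / cmod z^3) * (1 - 3 * (Im z / cmod z)\<^sup>2)"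
    "attraction_xy z = -3 * ((1 / cmod z^3) * (Re z / cmod z * (Im z / cmod z)))" if "z \<noteq> 0" for z
    using that by (auto simp: attraction_xx_def attraction_yy_def attraction_xy_def field_simps eval_nat_numeral)
  have "(attraction_xx (1+w) - attraction_xx (1-w)) * (attraction_yy (1+w) - attraction_yy (1-w)) - (attraction_xy (1+w) - attraction_xy (1-w))\<^sup>2
    = - 2 * (1/r1^3 - 1/r2^3)\<^sup>2 - 9 * (1/r1^3) * (1/r2^3) * (a * d - b * c)\<^sup>2"
    unfolding id[symmetric] e[OF quadrant_avoids_unit(1)[OF assms]] e[OF quadrant_avoids_unit(2)[OF assms]]
    by (fold r1_def r2_def, fold a_def b_def c_def d_def) (simp add: power2_eq_square algebra_simps)
  moreover have "a * d - b * c \<noteq> 0"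
  proof -
    have "a * d - b * c = - 2 * Im w / (r1 * r2)"
      using r by (simp add: a_def b_def c_def d_def field_simps)
    then show ?thesis using r assms by (simp add: quadrant_def)
  qed
  then have "9 * (1/r1^3) * (1/r2^3) * (a * d - b * c)\<^sup>2 > 0" using r by simp
  moreover have "(1/r1^3 - 1/r2^3)\<^sup>2 \<ge> 0" by simp
  ultimately show ?thesis by linarith
qed

lemma open_quadrant: "open quadrant"
  unfolding quadrant_def by (intro open_Collect_conj open_Collect_less continuous_intros)

text \<open>
  The Jacobian is invertible and depends continuously on the point, so the inverse function theorem applies;
  the inverse matrix is written down by Cramer's rule.
\<close>

lemma pair_field_locally_injective:
  assumes "a \<in> quadrant"
  obtains r where "r > 0" "ball a r \<subseteq> quadrant" "inj_on pair_field (ball a r)"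
proof -
  define A where "A = (\<lambda>w. attraction_xx (1+w) - attraction_xx (1-w))"
  define B where "B = (\<lambda>w. attraction_xy (1+w) - attraction_xy (1-w))"
  define C where "C = (\<lambda>w. attraction_yy (1+w) - attraction_yy (1-w))"
  define D where "D = A a * C a - (B a)\<^sup>2"
  have D: "D \<noteq> 0" using pair_field_jacobian_det_neg[OF assms] by (simp add: D_def A_def B_def C_def)
  have pair_field_jacobian: "pair_field_jacobian w h = Complex (A w * Re h + B w * Im h) (B w * Re h + C w * Im h)" for w h
    by (simp add: pair_field_jacobian_def A_def B_def C_def)
  define g where "g = (\<lambda>k. Complex ((C a * Re k - B a * Im k) / D) ((A a * Im k - B a * Re k) / D))"
  have "linear g"
    by (rule linearI) (simp_all add: g_def complex_eq_iff algebra_simps diff_divide_distrib add_divide_distrib)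
  then have g: "bounded_linear g" by (simp add: linear_linear)
  have left_inverse: "g \<circ> pair_field_jacobian a = id"
  proof
    fix h
    have "C a * (A a * Re h + B a * Im h) - B a * (B a * Re h + C a * Im h) = D * Re h"
      "A a * (B a * Re h + C a * Im h) - B a * (A a * Re h + B a * Im h) = D * Im h"
      by (simp_all add: D_def algebra_simps power2_eq_square)
    then show "(g \<circ> pair_field_jacobian a) h = id h" using D by (simp add: g_def pair_field_jacobian complex_eq_iff)
  qed
  define c where "c = (\<lambda>w. \<bar>A w - A a\<bar> + 2 * \<bar>B w - B a\<bar> + \<bar>C w - C a\<bar>)"
  have cont: "isCont c a"
    using quadrant_avoids_unit[OF assms]
    unfolding c_def A_def B_def C_def attraction_xx_def attraction_xy_def attraction_yy_def
    by (auto intro!: continuous_intros)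
  have "\<exists>d>0. \<forall>x. dist a x < d \<longrightarrow> onorm (\<lambda>v. pair_field_jacobian x v - pair_field_jacobian a v) < e" if "e > 0" for e
  proof -
    obtain d where d: "d > 0" "\<And>x. dist x a < d \<Longrightarrow> dist (c x) (c a) < e"
      using cont \<open>e > 0\<close> unfolding continuous_at_eps_delta by blast
    have "onorm (\<lambda>v. pair_field_jacobian x v - pair_field_jacobian a v) < e" if "dist a x < d" for x
    proof -
      have "norm (pair_field_jacobian x v - pair_field_jacobian a v) \<le> c x * norm v" for v
      proof -
        have "norm (pair_field_jacobian x v - pair_field_jacobian a v) \<le> \<bar>Re (pair_field_jacobian x v - pair_field_jacobian a v)\<bar> + \<bar>Im (pair_field_jacobian x v - pair_field_jacobian a v)\<bar>" by (rule cmod_le)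
        also have "\<dots> = \<bar>(A x - A a) * Re v + (B x - B a) * Im v\<bar> + \<bar>(B x - B a) * Re v + (C x - C a) * Im v\<bar>"
          by (simp add: pair_field_jacobian algebra_simps)
        also have "\<dots> \<le> (\<bar>A x - A a\<bar> * \<bar>Re v\<bar> + \<bar>B x - B a\<bar> * \<bar>Im v\<bar>) + (\<bar>B x - B a\<bar> * \<bar>Re v\<bar> + \<bar>C x - C a\<bar> * \<bar>Im v\<bar>)"
          by (intro add_mono order.trans[OF abs_triangle_ineq]) (simp_all add: abs_mult)
        also have "\<dots> \<le> (\<bar>A x - A a\<bar> * norm v + \<bar>B x - B a\<bar> * norm v) + (\<bar>B x - B a\<bar> * norm v + \<bar>C x - C a\<bar> * norm v)"
          by (intro add_mono mult_left_mono abs_Re_le_cmod abs_Im_le_cmod) auto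
        also have "\<dots> = c x * norm v" by (simp add: c_def algebra_simps)
        finally show ?thesis .
      qed
      then have "onorm (\<lambda>v. pair_field_jacobian x v - pair_field_jacobian a v) \<le> c x" by (rule onorm_le)
      also have "c x < e" using d(2)[of x] that by (simp add: dist_commute c_def dist_real_def)
      finally show ?thesis .
    qed
    then show ?thesis using d(1) by blast
  qed
  note near = this
  have "(pair_field has_derivative pair_field_jacobian w) (at w)" if "w \<in> quadrant" for w
    using pair_field_has_derivative quadrant_avoids_unit[OF that] by blast
  from has_derivative_locally_injective[where f = pair_field and f' = pair_field_jacobian, OF assms open_quadrant g left_inverse this near]
  show ?thesis using that by metis
qed

section \<open>Properness on the quadrant\<close>

definition lower_half_plane :: "complex set" where "lower_half_plane = {q. Im q < 0}"

lemma pair_field_quadrant_lower: assumes "w \<in> quadrant" shows "pair_field w \<in> lower_half_plane"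
proof -
  have w: "Re w > 0" "Im w > 0" using assms by (auto simp: quadrant_def)
  have "cmod (1 - w) < cmod (1 + w)"
    using w by (simp add: cmod_def power2_eq_square algebra_simps)
  then have "cmod (1 - w)^3 < cmod (1 + w)^3" by (intro power_strict_mono) auto
  moreover have "0 < cmod (1 - w)" using quadrant_avoids_unit[OF assms] by simp
  ultimately have "1 / cmod (1 + w)^3 < 1 / cmod (1 - w)^3" using quadrant_avoids_unit[OF assms] by (intro divide_strict_left_mono) auto
  then show ?thesis using w by (simp add: lower_half_plane_def Im_pair_field mult_pos_neg)
qed

lemma norm_attraction: "norm (attraction z) = 1 / (norm z)\<^sup>2"
  by (cases "z = 0") (simp_all add: attraction_def eval_nat_numeral)

lemma isCont_pair_field: "1 + w \<noteq> 0 \<Longrightarrow> 1 - w \<noteq> 0 \<Longrightarrow> isCont pair_field w"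
  using pair_field_has_derivative has_derivative_continuous by blast

text \<open>
  Properness in terms of sequences. A sequence in the quadrant whose images converge to a point \<open>q\<close> of the
  open half plane can neither run to infinity, where the field vanishes, nor to \<open>1\<close>, where it is
  unbounded, nor to another point of the boundary, where the field is real.
\<close>

lemma pair_field_proper:
  fixes u :: "nat \<Rightarrow> complex"
  assumes u: "\<And>n. u n \<in> quadrant" and lim: "(\<lambda>n. pair_field (u n)) \<longlonglongrightarrow> q" and q: "q \<in> lower_half_plane"
  obtains l s where "strict_mono s" "(u \<circ> s) \<longlonglongrightarrow> l" "l \<in> quadrant" "pair_field l = q"
proof -
  have qp: "norm q > 0" using q by (auto simp: lower_half_plane_def)
  have "eventually (\<lambda>n. norm (pair_field (u n)) > norm q / 2) sequentially"
    using qp by (intro order_tendstoD(1)[OF tendsto_norm[OF lim]]) simp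
  then obtain N where N: "\<And>n. n \<ge> N \<Longrightarrow> norm (pair_field (u n)) > norm q / 2"
    by (auto simp: eventually_sequentially)
  define R where "R = 1 + sqrt (4 / norm q)"
  \<comment> \<open>Beyond the radius \<open>R\<close> each of the two attractions is shorter than a quarter of \<open>norm q\<close>.\<close>
  have bd: "norm (u n) \<le> R" if "n \<ge> N" for n
  proof (rule ccontr)
    assume "\<not> norm (u n) \<le> R"
    then have R: "norm (u n) - 1 > sqrt (4 / norm q)" by (simp add: R_def)
    have s0: "sqrt (4 / norm q) > 0" using qp by simp
    have 1: "norm (attraction z) < norm q / 4" if "norm z \<ge> norm (u n) - 1" for z :: complex
    proof -
      have "(sqrt (4 / norm q))\<^sup>2 < (norm z)\<^sup>2" using R that s0 by (intro power_strict_mono) auto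
      then have "4 / norm q < (norm z)\<^sup>2" using qp by simp
      moreover have "4 / norm q > 0" using qp by simp
      ultimately have "1 / (norm z)\<^sup>2 < 1 / (4 / norm q)" by (simp only: frac_less2 order_refl zero_less_one)
      then show ?thesis by (simp add: norm_attraction)
    qed
    have "norm (1 + u n) \<ge> norm (u n) - 1" "norm (1 - u n) \<ge> norm (u n) - 1"
      using norm_triangle_ineq2[of "u n" "-1"] norm_triangle_ineq2[of "u n" "1"]
      by (simp_all add: add.commute norm_minus_commute)
    then have "norm (attraction (1 + u n)) + norm (attraction (1 - u n)) < norm q / 2" using 1[of "1 + u n"] 1[of "1 - u n"] by linarith
    then show False using N[OF that] norm_triangle_ineq[of "attraction (1 + u n)" "attraction (1 - u n)"] by (simp add: pair_field_def)
  qed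
  have "\<forall>n. u (n + N) \<in> cball 0 R" using bd by simp
  then obtain l s where s: "strict_mono s" and l: "((\<lambda>n. u (n + N)) \<circ> s) \<longlonglongrightarrow> l"
    using compact_cball[of "0::complex" R] unfolding compact_def by metis
  define s' where "s' = (\<lambda>n. s n + N)"
  have s': "strict_mono s'" using s by (simp add: s'_def strict_mono_def)
  have l': "(\<lambda>n. u (s' n)) \<longlonglongrightarrow> l" using l by (simp add: s'_def o_def)
  have lim': "(\<lambda>n. pair_field (u (s' n))) \<longlonglongrightarrow> q" using LIMSEQ_subseq_LIMSEQ[OF lim s'] by (simp add: o_def)
  have pos: "Re (u n) > 0" "Im (u n) > 0" for n using u by (auto simp: quadrant_def)
  have lpos: "Re l \<ge> 0" "Im l \<ge> 0"
    using LIMSEQ_le_const[OF tendsto_Re[OF l']] LIMSEQ_le_const[OF tendsto_Im[OF l']] pos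
    by (meson less_imp_le)+
  have p: "1 + l \<noteq> 0" using lpos by (auto simp: complex_eq_iff)
  have m: "1 - l \<noteq> 0"
  proof
    assume "1 - l = 0"
    then have "l = 1" by simp
    have tV: "(\<lambda>n. attraction (1 + u (s' n))) \<longlonglongrightarrow> attraction (1 + l)"
      using p unfolding attraction_def by (auto intro!: tendsto_intros l')
    have "(\<lambda>n. pair_field (u (s' n)) - attraction (1 + u (s' n))) \<longlonglongrightarrow> q - attraction (1 + l)"
      by (intro tendsto_diff lim' tV)
    then have "(\<lambda>n. attraction (1 - u (s' n))) \<longlonglongrightarrow> q - attraction (1 + l)" by (simp add: pair_field_def)
    \<comment> \<open>These products are constantly 1, but their limit would be 0.\<close>
    then have "(\<lambda>n. (norm (1 - u (s' n)))\<^sup>2 * norm (attraction (1 - u (s' n)))) \<longlonglongrightarrow> (norm (1 - l))\<^sup>2 * norm (q - attraction (1 + l))"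
      by (intro tendsto_intros l')
    moreover have "(norm (1 - u (s' n)))\<^sup>2 * norm (attraction (1 - u (s' n))) = 1" for n
      using quadrant_avoids_unit[OF u[of "s' n"]] by (simp add: norm_attraction)
    ultimately have "(\<lambda>n::nat. 1::real) \<longlonglongrightarrow> 0" using \<open>l = 1\<close> by simp
    then show False by (simp add: LIMSEQ_const_iff)
  qed
  have dl: "pair_field l = q"
    using LIMSEQ_unique[OF isCont_tendsto_compose[OF isCont_pair_field[OF p m] l'] lim'] .
  have "Re l \<noteq> 0"
  proof
    assume 0: "Re l = 0"
    then have "cmod (1 + l) = cmod (1 - l)" by (simp add: cmod_def)
    then have "Im (pair_field l) = 0" by (simp add: Im_pair_field)
    then show False using q dl by (simp add: lower_half_plane_def)
  qed
  moreover have "Im l \<noteq> 0"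
    using q dl by (auto simp: lower_half_plane_def Im_pair_field)
  ultimately have "l \<in> quadrant" using lpos by (simp add: quadrant_def)
  then show ?thesis using that[OF s' _ _ dl] l' by (simp add: o_def)
qed

section \<open>Injectivity over the imaginary values\<close>

lemma equal_chord_relation:
  fixes y z :: real
  assumes "y\<^sup>2 - y ^ 3 = z\<^sup>2 - z ^ 3" "y < z"
  shows "y + z = y\<^sup>2 + y * z + z\<^sup>2"
proof -
  have "(y - z) * (y + z - (y\<^sup>2 + y * z + z\<^sup>2)) = (y\<^sup>2 - y ^ 3) - (z\<^sup>2 - z ^ 3)"
    by (simp add: algebra_simps power2_eq_square power3_eq_cube)
  then show ?thesis using assms by simp
qed

text \<open>
  On the curve \<open>y + z = y^2 + y z + z^2\<close> in the positive quadrant one coordinate decreases as the other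
  increases, because \<open>y + z > 1\<close> there.
\<close>

lemma equal_chord_antimono:
  fixes y z y' z' :: real
  assumes "0 < y" "0 < z" "0 < y'" "0 < z'"
    and "y + z = y\<^sup>2 + y * z + z\<^sup>2" "y' + z' = y'\<^sup>2 + y' * z' + z'\<^sup>2" "y' \<le> y"
  shows "z < z' \<or> (y = y' \<and> z = z')"
proof -
  have gt1: "p + q > 1" if "p > 0" "q > 0" "p + q = p\<^sup>2 + p * q + q\<^sup>2" for p q :: real
  proof -
    have "(p + q) * (p + q - 1) = p * q" using that(3) by algebra
    then have "(p + q) * (p + q - 1) > 0" using that by simp
    then show ?thesis using that zero_less_mult_pos[of "p + q" "p + q - 1"] by simp
  qed
  have p: "y + y' + z - 1 > 0" "z + z' + y' - 1 > 0"
    using gt1[of y z] gt1[of y' z'] assms by auto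
  have "(y - y') * (y + y' + z - 1) + (z - z') * (z + z' + y' - 1) = 0"
    using assms(5,6) by (simp add: algebra_simps power2_eq_square)
  moreover have "(y - y') * (y + y' + z - 1) \<ge> 0" using p assms by simp
  moreover have "(z - z') * (z + z' + y' - 1) \<ge> 0" if "z \<ge> z'" using p that by simp
  ultimately show ?thesis using p assms(7) by (smt (verit) mult_eq_0_iff)
qed

text \<open>
  Let \<open>s1, s2\<close> be the sines and \<open>c1, c2\<close> the cotangents of the angles of the vectors \<open>w + 1\<close> and
  \<open>w - 1\<close> with the real axis. The real part of the field vanishes iff \<open>c1 s1^3 = c2 s2^3\<close>, which for the
  squares of the sines is \<open>equal_chord_relation\<close>. Hence, if \<open>s1\<close> becomes smaller then \<open>s2\<close> becomes
  larger and \<open>c1 - c2\<close> grows, and with them the imaginary part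
  \<open>(s2^3 - s1^3) (c1 - c2)^2 / 4\<close> of the negative field.
\<close>

lemma pair_field_inj_on_imaginary_values:
  assumes "u \<in> quadrant" "v \<in> quadrant" "pair_field u = pair_field v" "Re (pair_field u) = 0"
  shows "u = v"
proof -
  have wlog: "u = v" if u: "u \<in> quadrant" and v: "v \<in> quadrant" and e: "pair_field u = pair_field v" and R: "Re (pair_field u) = 0"
    and le: "Im v / cmod (1 + v) \<le> Im u / cmod (1 + u)" for u v
  proof -
    define s1 s2 c1 c2 where "s1 = (\<lambda>w. Im w / cmod (1 + w))" and "s2 = (\<lambda>w. Im w / cmod (1 - w))"
      and "c1 = (\<lambda>w. (Re w + 1) / Im w)" and "c2 = (\<lambda>w. (Re w - 1) / Im w)"
    have facts: "0 < s1 w" "s1 w < s2 w" "0 < c1 w" "0 < c2 w" "(s1 w)\<^sup>2 = 1 / (1 + (c1 w)\<^sup>2)"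
      "(s2 w)\<^sup>2 = 1 / (1 + (c2 w)\<^sup>2)"
      "(s1 w)\<^sup>2 + (s2 w)\<^sup>2 = ((s1 w)\<^sup>2)\<^sup>2 + (s1 w)\<^sup>2 * (s2 w)\<^sup>2 + ((s2 w)\<^sup>2)\<^sup>2"
      "- Im (pair_field w) = (s2 w ^ 3 - s1 w ^ 3) * (c1 w - c2 w)\<^sup>2 / 4"
      if w: "w \<in> quadrant" and R: "Re (pair_field w) = 0" for w
    proof -
      have p: "Re w > 0" "Im w > 0" using w by (auto simp: quadrant_def)
      have n: "cmod (1 + w) > 0" "cmod (1 - w) > 0" using quadrant_avoids_unit[OF w] by auto
      have lt: "cmod (1 - w) < cmod (1 + w)"
        using p by (simp add: cmod_def power2_eq_square algebra_simps)
      have sq: "(cmod (1 + w))\<^sup>2 = (Re w + 1)\<^sup>2 + (Im w)\<^sup>2" "(cmod (1 - w))\<^sup>2 = (Re w - 1)\<^sup>2 + (Im w)\<^sup>2"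
        unfolding cmod_power2 by (simp_all add: power2_eq_square algebra_simps)
      have bal: "(Re w + 1) / cmod (1 + w) ^ 3 = (Re w - 1) / cmod (1 - w) ^ 3"
        using R by (simp add: Re_pair_field diff_divide_distrib add_divide_distrib)
      have "(Re w + 1) / cmod (1 + w) ^ 3 > 0" using p n by simp
      then have X: "Re w - 1 > 0" using bal n by (simp add: zero_less_divide_iff)
      show 1: "0 < s1 w" "s1 w < s2 w" using p n lt by (simp_all add: s1_def s2_def divide_strict_left_mono)
      show "0 < c1 w" "0 < c2 w" using p X by (simp_all add: c1_def c2_def)
      have "1 + (c1 w)\<^sup>2 = (cmod (1 + w))\<^sup>2 / (Im w)\<^sup>2" "1 + (c2 w)\<^sup>2 = (cmod (1 - w))\<^sup>2 / (Im w)\<^sup>2"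
        unfolding sq c1_def c2_def using p by (simp_all add: field_simps)
      then show "(s1 w)\<^sup>2 = 1 / (1 + (c1 w)\<^sup>2)" "(s2 w)\<^sup>2 = 1 / (1 + (c2 w)\<^sup>2)"
        using p n by (simp_all add: s1_def s2_def power_divide)
      have k: "((y / r)\<^sup>2)\<^sup>2 - ((y / r)\<^sup>2) ^ 3 = y ^ 4 * ((r\<^sup>2 - y\<^sup>2) / r ^ 6)"
        if "r > 0" for r y :: real
        using that by (simp add: field_simps eval_nat_numeral)
      have "((s1 w)\<^sup>2)\<^sup>2 - ((s1 w)\<^sup>2) ^ 3 = (Im w)^4 * ((Re w + 1) / cmod (1 + w) ^ 3)\<^sup>2"
        using k[of "cmod (1+w)" "Im w"] n by (simp add: s1_def sq power_divide power_mult[symmetric])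
      moreover have "((s2 w)\<^sup>2)\<^sup>2 - ((s2 w)\<^sup>2) ^ 3 = (Im w)^4 * ((Re w - 1) / cmod (1 - w) ^ 3)\<^sup>2"
        using k[of "cmod (1-w)" "Im w"] n by (simp add: s2_def sq power_divide power_mult[symmetric])
      moreover have "(s1 w)\<^sup>2 < (s2 w)\<^sup>2" using 1 by (intro power_strict_mono) auto
      ultimately show "(s1 w)\<^sup>2 + (s2 w)\<^sup>2 = ((s1 w)\<^sup>2)\<^sup>2 + (s1 w)\<^sup>2 * (s2 w)\<^sup>2 + ((s2 w)\<^sup>2)\<^sup>2"
        using bal by (intro equal_chord_relation) auto
      have cc: "c1 w - c2 w = 2 / Im w" using p by (simp add: c1_def c2_def field_simps)
      have "y * (1 / r ^ 3 - 1 / t ^ 3) = - (((y / t) ^ 3 - (y / r) ^ 3) * (2 / y)\<^sup>2 / 4)"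
        if "y > 0" "r > 0" "t > 0" for y r t :: real
        using that by (simp add: field_simps eval_nat_numeral)
      then show "- Im (pair_field w) = (s2 w ^ 3 - s1 w ^ 3) * (c1 w - c2 w)\<^sup>2 / 4"
        unfolding cc Im_pair_field s1_def s2_def using p n by simp
    qed
    note fu = facts[OF u R] and fv = facts[OF v R[unfolded e]]
    have mono: "1 / (1 + c'\<^sup>2) < 1 / (1 + c\<^sup>2)" if "0 < c" "c < c'" for c c' :: real
    proof -
      have "c\<^sup>2 < c'\<^sup>2" using that by (intro power_strict_mono) auto
      moreover have "0 < 1 + c\<^sup>2" by (simp add: add_pos_nonneg)
      ultimately show ?thesis by (intro frac_less2) auto
    qed
    have leq: "c' \<le> c" if "1 / (1 + c\<^sup>2) \<le> 1 / (1 + c'\<^sup>2)" "0 < c" for c c' :: real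
      using mono[of c c'] that by linarith
    have less: "c' < c" if "1 / (1 + c\<^sup>2) < 1 / (1 + c'\<^sup>2)" "0 < c" for c c' :: real
      using leq[of c c'] that by (cases "c = c'") auto
    have eq: "c' = c" if "1 / (1 + c\<^sup>2) = 1 / (1 + c'\<^sup>2)" "0 < c" "0 < c'" for c c' :: real
      using leq[of c c'] leq[of c' c] that by simp
    have "(s1 v)\<^sup>2 \<le> (s1 u)\<^sup>2" using le fv(1) by (simp add: s1_def power_mono)
    moreover have "0 < (s1 u)\<^sup>2" "0 < (s2 u)\<^sup>2" "0 < (s1 v)\<^sup>2" "0 < (s2 v)\<^sup>2"
      using fu(1,2) fv(1,2) by simp_all
    ultimately consider "(s2 u)\<^sup>2 < (s2 v)\<^sup>2" | "(s1 u)\<^sup>2 = (s1 v)\<^sup>2" "(s2 u)\<^sup>2 = (s2 v)\<^sup>2"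
      using equal_chord_antimono[OF _ _ _ _ fu(7) fv(7)] by blast
    then show "u = v"
    proof cases
      case 1
      have "c2 v < c2 u" using less[of "c2 u" "c2 v"] 1 fu(4,6) fv(6) by simp
      moreover have "c1 u \<le> c1 v" using leq[of "c1 v" "c1 u"] \<open>(s1 v)\<^sup>2 \<le> (s1 u)\<^sup>2\<close> fu(5) fv(3,5) by simp
      moreover have "c2 u < c1 u" using less[of "c1 u" "c2 u"] fu(1,2,3,5,6) power_strict_mono[of "s1 u" "s2 u" 2] by simp
      ultimately have "0 < c1 u - c2 u" "c1 u - c2 u < c1 v - c2 v" by auto
      then have cc: "0 < (c1 u - c2 u)\<^sup>2" "(c1 u - c2 u)\<^sup>2 < (c1 v - c2 v)\<^sup>2"
        by (simp, intro power_strict_mono, auto)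
      have "s2 u < s2 v" using 1 fv(1,2) by (intro power2_less_imp_less[of "s2 u" "s2 v"]) auto
      then have "s2 u ^ 3 < s2 v ^ 3" using fu(1,2) by (intro power_strict_mono) auto
      moreover have "s1 v ^ 3 \<le> s1 u ^ 3" using fv(1) le by (intro power_mono) (auto simp: s1_def)
      moreover have "s1 u ^ 3 < s2 u ^ 3" using fu(1,2) by (intro power_strict_mono) auto
      ultimately have "0 < s2 u ^ 3 - s1 u ^ 3" "s2 u ^ 3 - s1 u ^ 3 < s2 v ^ 3 - s1 v ^ 3" by auto
      then have "(s2 u ^ 3 - s1 u ^ 3) * (c1 u - c2 u)\<^sup>2 < (s2 v ^ 3 - s1 v ^ 3) * (c1 v - c2 v)\<^sup>2"
        using cc by (intro mult_strict_mono) auto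
      then show ?thesis using fu(8) fv(8) e by simp
    next
      case 2
      then have c: "c1 u = c1 v" "c2 u = c2 v" using fu(3-6) fv(3-6) by (auto intro!: eq)
      have "Im u \<noteq> 0" "Im v \<noteq> 0" using u v by (auto simp: quadrant_def)
      then have "2 / Im u = 2 / Im v" using c by (simp add: c1_def c2_def field_simps)
      then have "Im u = Im v" by simp
      moreover have "Re u = Re v" using c(1) \<open>Im u = Im v\<close> \<open>Im u \<noteq> 0\<close> by (simp add: c1_def)
      ultimately show ?thesis by (simp add: complex_eq_iff)
    qed
  qed
  show ?thesis
    using wlog[of u v] wlog[of v u] assms linear[of "Im v / cmod (1 + v)" "Im u / cmod (1 + u)"] by metis
qed

section \<open>Global injectivity\<close>

text \<open>
  The set \<open>W\<close> of values attained twice is open because the field is an open map near each of the two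
  preimages. It is closed in the half plane by properness: the two sequences of preimages
  subconverge, and by local injectivity they do not have the same limit.
\<close>

lemma inj_on_pair_field_quadrant: "inj_on pair_field quadrant"
proof -
  define W where "W = {q \<in> lower_half_plane. \<exists>u\<in>quadrant. \<exists>v\<in>quadrant. u \<noteq> v \<and> pair_field u = q \<and> pair_field v = q}"
  have cont: "continuous_on quadrant pair_field"
    using isCont_pair_field quadrant_avoids_unit by (intro continuous_at_imp_continuous_on) blast
  have "open W"
  proof (rule Topological_Spaces.openI)
    fix q assume "q \<in> W"
    then obtain u v where uv: "u \<in> quadrant" "v \<in> quadrant" "u \<noteq> v" "pair_field u = q" "pair_field v = q" by (auto simp: W_def)
    obtain r where r: "r > 0" "ball u r \<subseteq> quadrant" "inj_on pair_field (ball u r)" using pair_field_locally_injective[OF uv(1)] .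
    obtain s where s: "s > 0" "ball v s \<subseteq> quadrant" "inj_on pair_field (ball v s)" using pair_field_locally_injective[OF uv(2)] .
    obtain A B where AB: "open A" "open B" "u \<in> A" "v \<in> B" "A \<inter> B = {}"
      using hausdorff[OF uv(3)] by blast
    have op: "open (pair_field ` (ball x t \<inter> C))" if "ball x t \<subseteq> quadrant" "inj_on pair_field (ball x t)" "open C" for x t C
    proof (rule invariance_of_domain)
      show "continuous_on (ball x t \<inter> C) pair_field" using cont that(1) by (auto intro: continuous_on_subset)
      show "inj_on pair_field (ball x t \<inter> C)" using that(2) by (auto intro: inj_on_subset)
    qed (use that in auto)
    let ?T = "pair_field ` (ball u r \<inter> A) \<inter> pair_field ` (ball v s \<inter> B)"
    have "open ?T" using op r s AB by blast
    moreover have "q \<in> ?T"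
    proof
      have "u \<in> ball u r \<inter> A" "v \<in> ball v s \<inter> B" using r(1) s(1) AB(3,4) by simp_all
      then show "q \<in> pair_field ` (ball u r \<inter> A)" "q \<in> pair_field ` (ball v s \<inter> B)"
        using imageI[of u "ball u r \<inter> A" pair_field] imageI[of v "ball v s \<inter> B" pair_field] uv(4,5) by simp_all
    qed
    moreover have "?T \<subseteq> W"
    proof
      fix k assume "k \<in> ?T"
      then have "k \<in> pair_field ` (ball u r \<inter> A)" "k \<in> pair_field ` (ball v s \<inter> B)" by (rule IntD1, rule IntD2)
      then obtain u' v' where u': "u' \<in> ball u r" "u' \<in> A" "pair_field u' = k" and v': "v' \<in> ball v s" "v' \<in> B" "pair_field v' = k"
        by (elim imageE IntE) (metis (no_types))
      have "u' \<in> quadrant" "v' \<in> quadrant" "u' \<noteq> v'" using u' v' r(2) s(2) AB(5) by auto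
      then show "k \<in> W" using u'(3) v'(3) pair_field_quadrant_lower[of u'] unfolding W_def by blast
    qed
    ultimately show "\<exists>T. open T \<and> q \<in> T \<and> T \<subseteq> W" by (intro exI[of _ ?T]) simp
  qed
  then have "openin (top_of_set lower_half_plane) W" by (simp add: open_subset W_def)
  moreover have "closedin (top_of_set lower_half_plane) W"
    unfolding closedin_limpt
  proof (intro conjI allI impI)
    show "W \<subseteq> lower_half_plane" by (auto simp: W_def)
    fix q assume q: "q islimpt W \<and> q \<in> lower_half_plane"
    then obtain x where "\<forall>n. x n \<in> W - {q}" "x \<longlonglongrightarrow> q" unfolding islimpt_sequential by blast
    with q have x: "(\<forall>n. x n \<in> W) \<and> x \<longlonglongrightarrow> q \<and> q \<in> lower_half_plane" by blast
    then have "\<forall>n. \<exists>u v. u \<in> quadrant \<and> v \<in> quadrant \<and> u \<noteq> v \<and> pair_field u = x n \<and> pair_field v = x n"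
      unfolding W_def by blast
    then obtain u v where uv: "\<And>n. u n \<in> quadrant" "\<And>n. v n \<in> quadrant" "\<And>n. u n \<noteq> v n" "\<And>n. pair_field (u n) = x n" "\<And>n. pair_field (v n) = x n"
      by metis
    have "(\<lambda>n. pair_field (u n)) \<longlonglongrightarrow> q" using x uv(4) by simp
    from pair_field_proper[OF uv(1) this] x
    obtain l s where s: "strict_mono s" "(u \<circ> s) \<longlonglongrightarrow> l" "l \<in> quadrant" "pair_field l = q" by blast
    have "(\<lambda>n. pair_field ((v \<circ> s) n)) \<longlonglongrightarrow> q"
      using LIMSEQ_subseq_LIMSEQ[of x q s] x s(1) uv(5) by (simp add: o_def)
    moreover have "(v \<circ> s) n \<in> quadrant" for n using uv(2) by simp
    ultimately obtain m t where t: "strict_mono t" "((v \<circ> s) \<circ> t) \<longlonglongrightarrow> m" "m \<in> quadrant" "pair_field m = q"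
      using pair_field_proper[of "v \<circ> s" q] x by blast
    have ut: "((u \<circ> s) \<circ> t) \<longlonglongrightarrow> l" using LIMSEQ_subseq_LIMSEQ[OF s(2) t(1)] .
    have "l \<noteq> m"
    proof
      assume "l = m"
      obtain r where r: "r > 0" "ball l r \<subseteq> quadrant" "inj_on pair_field (ball l r)" using pair_field_locally_injective[OF s(3)] .
      have "eventually (\<lambda>n. ((u \<circ> s) \<circ> t) n \<in> ball l r) sequentially"
        using topological_tendstoD[OF ut open_ball[of l r]] r(1) by simp
      moreover have "eventually (\<lambda>n. ((v \<circ> s) \<circ> t) n \<in> ball l r) sequentially"
        using topological_tendstoD[OF t(2) open_ball[of l r]] r(1) \<open>l = m\<close> by simp
      ultimately have "eventually (\<lambda>n. ((u \<circ> s) \<circ> t) n \<in> ball l r \<and> ((v \<circ> s) \<circ> t) n \<in> ball l r) sequentially"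
        by (rule eventually_conj)
      then have "\<exists>n. ((u \<circ> s) \<circ> t) n \<in> ball l r \<and> ((v \<circ> s) \<circ> t) n \<in> ball l r"
        by (rule eventually_happens'[OF sequentially_bot])
      then obtain n where n: "((u \<circ> s) \<circ> t) n \<in> ball l r \<and> ((v \<circ> s) \<circ> t) n \<in> ball l r"
        by (rule exE)
      have "pair_field (((u \<circ> s) \<circ> t) n) = pair_field (((v \<circ> s) \<circ> t) n)" by (simp add: uv(4,5))
      from inj_onD[OF r(3) this conjunct1[OF n] conjunct2[OF n]]
      show False using uv(3)[of "s (t n)"] by simp
    qed
    then show "q \<in> W" using s(3,4) t(3,4) x unfolding W_def by blast
  qed
  moreover have "connected lower_half_plane"
    unfolding lower_half_plane_def by (intro convex_connected) (simp add: convex_halfspace_Im_lt)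
  ultimately have "W = {} \<or> W = lower_half_plane" by (auto simp: connected_clopen)
  moreover have "- \<i> \<in> lower_half_plane" by (simp add: lower_half_plane_def)
  moreover have "- \<i> \<notin> W"
  proof
    assume "- \<i> \<in> W"
    then obtain u v where uv: "u \<in> quadrant" "v \<in> quadrant" "u \<noteq> v" "pair_field u = - \<i>" "pair_field v = - \<i>" unfolding W_def by blast
    then show False using pair_field_inj_on_imaginary_values[OF uv(1,2)] by simp
  qed
  ultimately have "W = {}" by blast
  then show ?thesis using pair_field_quadrant_lower unfolding inj_on_def W_def by blast
qed

lemma pair_field_cnj: "pair_field (cnj w) = cnj (pair_field w)"
proof -
  have "attraction (cnj z) = cnj (attraction z)" for z by (simp add: attraction_def complex_eq_iff)
  then show ?thesis unfolding pair_field_def by (metis complex_cnj_add complex_cnj_diff complex_cnj_one)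
qed

text \<open>
  The symmetries \<open>w \<mapsto> - w\<close> and \<open>w \<mapsto> cnj w\<close> reduce points off the axes to the quadrant. On
  the axes the field is real: it lies in \<open>(0, 2)\<close> on the punctured imaginary axis and outside that interval
  on the real axis.
\<close>

lemma pair_field_eq_imp:
  assumes nz: "1 + u \<noteq> 0" "1 - u \<noteq> 0" "1 + v \<noteq> 0" "1 - v \<noteq> 0"
    and eq: "pair_field u = pair_field v" and nreal: "Im u \<noteq> 0 \<or> Im v \<noteq> 0"
  shows "u = v \<or> u = - v"
proof -
  have pos: "u = v \<or> u = - v" if "pair_field u = pair_field v" "Im (pair_field u) < 0" for u v
  proof -
    have "w \<in> quadrant \<or> - w \<in> quadrant" if "Im (pair_field w) < 0" for w
    proof (rule ccontr)
      assume a: "\<not> ?thesis"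
      have "Im w \<noteq> 0" using that by (auto simp: Im_pair_field)
      moreover have "Re w \<noteq> 0"
      proof
        assume "Re w = 0"
        then have "cmod (1 + w) = cmod (1 - w)" by (simp add: cmod_def)
        then show False using that by (simp add: Im_pair_field)
      qed
      ultimately have "cnj w \<in> quadrant \<or> - cnj w \<in> quadrant" using a by (auto simp: quadrant_def)
      then have "pair_field (cnj w) \<in> lower_half_plane \<or> pair_field (- cnj w) \<in> lower_half_plane" using pair_field_quadrant_lower by blast
      then show False using that by (simp add: lower_half_plane_def pair_field_cnj pair_field_minus)
    qed
    then have "u \<in> quadrant \<or> - u \<in> quadrant" "v \<in> quadrant \<or> - v \<in> quadrant" using that by metis+
    moreover have "pair_field (- u) = pair_field u" "pair_field (- v) = pair_field v" by (rule pair_field_minus)+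
    ultimately show ?thesis using that(1) inj_on_pair_field_quadrant unfolding inj_on_def by (metis minus_minus)
  qed
  consider "Im (pair_field u) < 0" | "Im (pair_field u) > 0" | "Im (pair_field u) = 0" by linarith
  then show ?thesis
  proof cases
    case 1
    then show ?thesis using pos eq by blast
  next
    case 2
    then have "cnj u = cnj v \<or> cnj u = - cnj v" using eq by (intro pos) (simp_all add: pair_field_cnj)
    then show ?thesis by (metis complex_cnj_cnj complex_cnj_minus)
  next
    case 3
    have axis: "Re w = 0 \<or> Im w = 0" if "Im (pair_field w) = 0" "1 + w \<noteq> 0" "1 - w \<noteq> 0" for w
    proof (rule ccontr)
      assume "\<not> ?thesis"
      then have "w \<in> quadrant \<or> - w \<in> quadrant \<or> cnj w \<in> quadrant \<or> - cnj w \<in> quadrant" by (auto simp: quadrant_def)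
      then have "pair_field w \<in> lower_half_plane \<or> pair_field (- w) \<in> lower_half_plane \<or> pair_field (cnj w) \<in> lower_half_plane \<or> pair_field (- cnj w) \<in> lower_half_plane" using pair_field_quadrant_lower by blast
      then show False using that by (simp add: lower_half_plane_def pair_field_cnj pair_field_minus)
    qed
    have imag: "Re (pair_field w) = 2 / sqrt (1 + (Im w)\<^sup>2) ^ 3" if "Re w = 0" for w
      using that by (simp add: Re_pair_field cmod_def)
    have real: "Re (pair_field w) \<ge> 2 \<or> Re (pair_field w) < 0" if "Im w = 0" "1 + w \<noteq> 0" "1 - w \<noteq> 0" for w
    proof -
      define x where "x = Re w"
      have x: "x \<noteq> 1" "x \<noteq> -1" using that by (auto simp: x_def complex_eq_iff)
      have R: "Re (pair_field w) = (1 + x) / \<bar>1 + x\<bar> ^ 3 + (1 - x) / \<bar>1 - x\<bar> ^ 3"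
        using that(1) by (simp add: Re_pair_field cmod_eq_Re x_def)
      have h: "t / \<bar>t\<bar> ^ 3 = (if t > 0 then 1 / t\<^sup>2 else - (1 / t\<^sup>2))" for t :: real
        by (cases "t = 0") (auto simp: abs_if eval_nat_numeral)
      consider "x < -1" | "-1 < x" "x < 1" | "x > 1" using x by linarith
      then show ?thesis
      proof cases
        case 1
        then have "Re (pair_field w) = 1 / (1 - x)\<^sup>2 - 1 / (1 + x)\<^sup>2" by (simp add: R[unfolded h])
        moreover have "(1 + x)\<^sup>2 < (1 - x)\<^sup>2" using 1 by (simp add: power2_eq_square algebra_simps)
        then have "1 / (1 - x)\<^sup>2 < 1 / (1 + x)\<^sup>2" using 1 by (intro divide_strict_left_mono) auto
        ultimately show ?thesis by simp
      next
        case 2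
        then have a: "Re (pair_field w) = (1 / (1 + x))\<^sup>2 + (1 / (1 - x))\<^sup>2" by (simp add: R[unfolded h] power_divide)
        have "0 < (1 + x) * (1 - x)" "(1 + x) * (1 - x) \<le> 1" using 2 by (simp, simp add: algebra_simps)
        then have "1 \<le> 1 / ((1 + x) * (1 - x))" by (simp only: le_divide_eq_1_pos)
        moreover have "(1 / (1 + x))\<^sup>2 + (1 / (1 - x))\<^sup>2 \<ge> 2 * (1 / (1 + x)) * (1 / (1 - x))"
          by (rule sum_squares_bound)
        ultimately show ?thesis using a by simp
      next
        case 3
        then have "Re (pair_field w) = 1 / (1 + x)\<^sup>2 - 1 / (1 - x)\<^sup>2" by (simp add: R[unfolded h])
        moreover have "(1 - x)\<^sup>2 < (1 + x)\<^sup>2" using 3 by (simp add: power2_eq_square algebra_simps)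
        then have "1 / (1 + x)\<^sup>2 < 1 / (1 - x)\<^sup>2" using 3 by (intro divide_strict_left_mono) auto
        ultimately show ?thesis by simp
      qed
    qed
    have imag_range: "0 < Re (pair_field w) \<and> Re (pair_field w) < 2" if "Re w = 0" "Im w \<noteq> 0" for w
    proof -
      have "sqrt (1 + (Im w)\<^sup>2) > 1" using that by simp
      then have N: "sqrt (1 + (Im w)\<^sup>2) ^ 3 > 1" by (intro one_less_power) auto
      have "0 < 2 / N \<and> 2 / N < 2" if "1 < N" for N :: real using that by (simp add: divide_less_eq)
      from this[OF N] show ?thesis using imag[OF that(1)] by simp
    qed
    have ax: "Re u = 0 \<or> Im u = 0" "Re v = 0 \<or> Im v = 0" using axis 3 eq nz by auto
    then have R: "Re u = 0" "Re v = 0"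
      using imag_range[of u] imag_range[of v] real[of u] real[of v] nz nreal eq by force+
    have "sqrt (1 + (Im u)\<^sup>2) ^ 3 = sqrt (1 + (Im v)\<^sup>2) ^ 3"
      using imag[OF R(1)] imag[OF R(2)] eq by simp
    then have "sqrt (1 + (Im u)\<^sup>2) = sqrt (1 + (Im v)\<^sup>2)" by (rule power_eq_imp_eq_base) auto
    then have "Im u = Im v \<or> Im u = - Im v" by (simp add: power2_eq_iff)
    then show ?thesis using R by (auto simp: complex_eq_iff)
  qed
qed

lemma attraction_mult: "attraction (p * z) = (p / of_real (cmod p ^ 3)) * attraction z" for p z :: complex
  by (simp add: attraction_def norm_mult scaleR_conv_of_real power_mult_distrib)

text \<open>
  \<open>pair_field_eq_imp\<close> without coordinates: \<open>a, c, b, d\<close> are the consecutive vertices of a parallelogram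
  centred at \<open>(a + b) / 2\<close>, and scaling moves this centre to \<open>1\<close>.
\<close>

lemma balanced_diagonals:
  fixes a b c d :: complex
  assumes nz: "a \<noteq> 0" "b \<noteq> 0" "c \<noteq> 0" "d \<noteq> 0"
    and s: "a + b = c + d" and eq: "attraction a + attraction b = attraction c + attraction d"
  shows "a + b = 0 \<or> a = c \<or> a = d \<or> (\<exists>\<alpha> \<beta> :: real. b - a = \<alpha> *\<^sub>R (a + b) \<and> d - c = \<beta> *\<^sub>R (a + b))"
proof (cases "a + b = 0")
  case False
  define p u v where "p = (a + b) / 2" and "u = (a - b) / (a + b)" and "v = (c - d) / (a + b)"
  have p: "p \<noteq> 0" using False by (simp add: p_def)
  have "1 + u = 2 * a / (a + b)" "1 - u = 2 * b / (a + b)"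
    using False by (simp_all add: u_def divide_simps)
  then have e: "a = p * (1 + u)" "b = p * (1 - u)" using False by (simp_all add: p_def)
  have "1 + v = 2 * c / (a + b)" "1 - v = 2 * d / (a + b)"
    using False unfolding s by (simp_all add: v_def s divide_simps)
  then have e': "c = p * (1 + v)" "d = p * (1 - v)" using False by (simp_all add: p_def)
  have "(p / of_real (cmod p ^ 3)) * pair_field u = (p / of_real (cmod p ^ 3)) * pair_field v"
    using eq unfolding e e' attraction_mult pair_field_def by (simp add: distrib_left)
  then have d: "pair_field u = pair_field v" using p by simp
  show ?thesis
  proof (cases "Im u = 0 \<and> Im v = 0")
    case True
    then have "u = of_real (Re u)" "v = of_real (Re v)" by (simp_all add: complex_eq_iff)
    then have "b - a = (- Re u) *\<^sub>R (a + b)" "d - c = (- Re v) *\<^sub>R (a + b)"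
      unfolding scaleR_conv_of_real using False by (simp_all add: u_def v_def field_simps)
    then show ?thesis by blast
  next
    case False
    then have "u = v \<or> u = - v" using nz d unfolding e e' by (intro pair_field_eq_imp) auto
    then show ?thesis unfolding e e' by auto
  qed
qed simp

section \<open>Central configurations with multiplier zero are parallelograms\<close>

definition plane_to_complex :: "real^2 \<Rightarrow> complex" where
  "plane_to_complex r = Complex (r $ 1) (r $ 2)"

lemma plane_to_complex_linear [simp]:
  "plane_to_complex (r + s) = plane_to_complex r + plane_to_complex s"
  "plane_to_complex (r - s) = plane_to_complex r - plane_to_complex s"
  "plane_to_complex (c *\<^sub>R r) = c *\<^sub>R plane_to_complex r"
  by (simp_all add: plane_to_complex_def complex_eq_iff)

lemma plane_to_complex_eq_iff [simp]: "plane_to_complex r = plane_to_complex s \<longleftrightarrow> r = s"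
  by (auto simp: plane_to_complex_def vec_eq_iff forall_2)

lemma plane_to_complex_eq_0 [simp]: "plane_to_complex r = 0 \<longleftrightarrow> r = 0"
  by (auto simp: plane_to_complex_def vec_eq_iff forall_2 complex_eq_iff)

lemma norm_plane_to_complex [simp]: "norm (plane_to_complex r) = norm r"
  by (simp add: plane_to_complex_def cmod_def norm_vec_def L2_set_def sum_2)

lemma attraction_plane_to_complex: "attraction (plane_to_complex r) = plane_to_complex (attraction r)"
  by (simp add: attraction_def)

lemma balanced_diagonals_plane:
  fixes a b c d :: "real^2"
  assumes "a \<noteq> 0" "b \<noteq> 0" "c \<noteq> 0" "d \<noteq> 0" "a + b = c + d" "attraction a + attraction b = attraction c + attraction d"
  shows "a + b = 0 \<or> a = c \<or> a = d \<or> (\<exists>\<alpha> \<beta> :: real. b - a = \<alpha> *\<^sub>R (a + b) \<and> d - c = \<beta> *\<^sub>R (a + b))"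
proof -
  let ?f = plane_to_complex
  have "?f a + ?f b = ?f c + ?f d" "attraction (?f a) + attraction (?f b) = attraction (?f c) + attraction (?f d)"
    using assms(5,6) by (simp_all only: attraction_plane_to_complex plane_to_complex_linear(1)[symmetric])
  from balanced_diagonals[OF _ _ _ _ this] assms(1-4)
  have "?f (a + b) = 0 \<or> a = c \<or> a = d
     \<or> (\<exists>\<alpha> \<beta> :: real. ?f (b - a) = ?f (\<alpha> *\<^sub>R (a + b)) \<and> ?f (d - c) = ?f (\<beta> *\<^sub>R (a + b)))"
    by simp
  then show ?thesis by (simp only: plane_to_complex_eq_iff plane_to_complex_eq_0)
qed

lemma acceleration_four:
  fixes r1 :: "'a::euclidean_space"
  shows "acceleration [m1, m2, m3, m4] [r1, r2, r3, r4] 0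
      = m2 *\<^sub>R attraction (r2 - r1) + m3 *\<^sub>R attraction (r3 - r1) + m4 *\<^sub>R attraction (r4 - r1)"
    "acceleration [m1, m2, m3, m4] [r1, r2, r3, r4] 1
      = m1 *\<^sub>R attraction (r1 - r2) + m3 *\<^sub>R attraction (r3 - r2) + m4 *\<^sub>R attraction (r4 - r2)"
    "acceleration [m1, m2, m3, m4] [r1, r2, r3, r4] 2
      = m1 *\<^sub>R attraction (r1 - r3) + m2 *\<^sub>R attraction (r2 - r3) + m4 *\<^sub>R attraction (r4 - r3)"
    "acceleration [m1, m2, m3, m4] [r1, r2, r3, r4] 3
      = m1 *\<^sub>R attraction (r1 - r4) + m2 *\<^sub>R attraction (r2 - r4) + m3 *\<^sub>R attraction (r3 - r4)"
proof -
  have "{..<4} - {0} = {1, 2, 3::nat}" "{..<4} - {1} = {0, 2, 3::nat}"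
    "{..<4} - {2} = {0, 1, 3::nat}" "{..<4} - {3} = {0, 1, 2::nat}" by auto
  moreover have "length [m1, m2, m3, m4] = 4" by simp
  ultimately show "acceleration [m1, m2, m3, m4] [r1, r2, r3, r4] 0
      = m2 *\<^sub>R attraction (r2 - r1) + m3 *\<^sub>R attraction (r3 - r1) + m4 *\<^sub>R attraction (r4 - r1)"
    "acceleration [m1, m2, m3, m4] [r1, r2, r3, r4] 1
      = m1 *\<^sub>R attraction (r1 - r2) + m3 *\<^sub>R attraction (r3 - r2) + m4 *\<^sub>R attraction (r4 - r2)"
    "acceleration [m1, m2, m3, m4] [r1, r2, r3, r4] 2
      = m1 *\<^sub>R attraction (r1 - r3) + m2 *\<^sub>R attraction (r2 - r3) + m4 *\<^sub>R attraction (r4 - r3)"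
    "acceleration [m1, m2, m3, m4] [r1, r2, r3, r4] 3
      = m1 *\<^sub>R attraction (r1 - r4) + m2 *\<^sub>R attraction (r2 - r4) + m3 *\<^sub>R attraction (r3 - r4)"
    unfolding acceleration_def by (simp_all only:) (simp_all add: attraction_def nth_Cons' add.assoc)
qed

lemma planar_noncollinear_zero_cc_iff:
  "planar_noncollinear_cc 0 [m1, m2, m3, m4] [r1, r2, r3, r4] \<longleftrightarrow>
    m1 \<noteq> 0 \<and> m2 \<noteq> 0 \<and> m3 \<noteq> 0 \<and> m4 \<noteq> 0 \<and> distinct [r1, r2, r3, r4] \<and> \<not> collinear {r1, r2, r3, r4} \<and>
    (\<forall>i\<in>{1, 2, 3}. acceleration [m1, m2, m3, m4] [r1, r2, r3, r4] i = acceleration [m1, m2, m3, m4] [r1, r2, r3, r4] 0)"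
proof -
  have four: "(\<forall>i<4. P i) \<longleftrightarrow> P 0 \<and> P 1 \<and> P 2 \<and> P 3" for P :: "nat \<Rightarrow> bool"
    by (auto simp: eval_nat_numeral less_Suc_eq)
  have len: "length [m1, m2, m3, m4] = 4" "length [r1, r2, r3, r4] = 4" by simp_all
  show ?thesis
    unfolding planar_noncollinear_cc_def central_configuration_def len four by auto
qed

definition independent_pair :: "'a::real_vector \<Rightarrow> 'a \<Rightarrow> bool" where
  "independent_pair A B \<longleftrightarrow> (\<forall>\<alpha> \<beta>. \<alpha> *\<^sub>R A + \<beta> *\<^sub>R B = 0 \<longrightarrow> \<alpha> = 0 \<and> \<beta> = 0)"

lemma collinear_image_line: "collinear ((\<lambda>t. a + t *\<^sub>R u) ` S)"
  unfolding collinear_def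
proof (rule exI[of _ u], intro ballI)
  fix p q assume "p \<in> (\<lambda>t. a + t *\<^sub>R u) ` S" "q \<in> (\<lambda>t. a + t *\<^sub>R u) ` S"
  then obtain s t where "p = a + s *\<^sub>R u" "q = a + t *\<^sub>R u" by blast
  then show "\<exists>c. p - q = c *\<^sub>R u" by (intro exI[of _ "s - t"]) (simp add: scaleR_diff_left)
qed

lemma collinear_parallelogram_iff:
  fixes o' A B :: "'a::euclidean_space"
  shows "collinear {o' + A, o' - A, o' + B, o' - B} \<longleftrightarrow> \<not> independent_pair A B"
proof
  assume "collinear {o' + A, o' - A, o' + B, o' - B}"
  then obtain u where u: "\<And>x y. x \<in> {o' + A, o' - A, o' + B, o' - B} \<Longrightarrow> y \<in> {o' + A, o' - A, o' + B, o' - B} \<Longrightarrow> \<exists>c. x - y = c *\<^sub>R u"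
    unfolding collinear_def by blast
  obtain c d where "(o' + A) - (o' - A) = c *\<^sub>R u" "(o' + B) - (o' - B) = d *\<^sub>R u"
    using u[of "o' + A" "o' - A"] u[of "o' + B" "o' - B"] by auto
  then have "2 *\<^sub>R A = c *\<^sub>R u" "2 *\<^sub>R B = d *\<^sub>R u" by (simp_all add: scaleR_2)
  then have "A = (c / 2) *\<^sub>R u" "B = (d / 2) *\<^sub>R u"
    by (metis (no_types, lifting) scaleR_half_double scaleR_2 scaleR_scaleR divide_inverse mult.commute inverse_eq_divide mult_1)+
  then have "d *\<^sub>R A + (- c) *\<^sub>R B = 0" "c = 0 \<and> d = 0 \<longrightarrow> 1 *\<^sub>R A + 0 *\<^sub>R B = 0" by simp_all
  then show "\<not> independent_pair A B" unfolding independent_pair_def by (metis neg_0_equal_iff_equal zero_neq_one)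
next
  assume "\<not> independent_pair A B"
  then obtain \<alpha> \<beta> where ab: "\<alpha> *\<^sub>R A + \<beta> *\<^sub>R B = 0" "\<alpha> \<noteq> 0 \<or> \<beta> \<noteq> 0" by (auto simp: independent_pair_def)
  obtain u c d where A: "A = c *\<^sub>R u" and B: "B = d *\<^sub>R u"
  proof (cases "\<alpha> = 0")
    case True
    then have "A = 1 *\<^sub>R A" "B = 0 *\<^sub>R A" using ab by auto
    then show ?thesis using that by blast
  next
    case False
    have "\<alpha> *\<^sub>R A = - \<beta> *\<^sub>R B" using ab(1) by (simp add: eq_neg_iff_add_eq_0)
    then have "(1 / \<alpha>) *\<^sub>R (\<alpha> *\<^sub>R A) = (1 / \<alpha>) *\<^sub>R (- \<beta> *\<^sub>R B)" by simp
    then have "A = (- \<beta> / \<alpha>) *\<^sub>R B" using False by simp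
    moreover have "B = 1 *\<^sub>R B" by simp
    ultimately show ?thesis using that by blast
  qed
  have "{o' + A, o' - A, o' + B, o' - B} = (\<lambda>t. o' + t *\<^sub>R u) ` {c, - c, d, - d}" by (auto simp: A B)
  then show "collinear {o' + A, o' - A, o' + B, o' - B}"
    by (simp only: collinear_image_line)
qed

text \<open>
  Comparing the accelerations of bodies 1 and 2 suffices; the alternatives left open by
  \<open>balanced_diagonals_plane\<close> are excluded by distinct positions and by non-collinearity.
\<close>

lemma zero_cc_is_parallelogram:
  assumes "planar_noncollinear_cc 0 [x, - x, y, - y] [r1, r2, r3, r4]"
  shows "r1 + r2 = r3 + r4"
proof -
  note cc = assms[unfolded planar_noncollinear_zero_cc_iff]
  have y: "y \<noteq> 0" and d: "distinct [r1, r2, r3, r4]" and nc: "\<not> collinear {r1, r2, r3, r4}" using cc by auto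
  have "acceleration [x, - x, y, - y] [r1, r2, r3, r4] 1 = acceleration [x, - x, y, - y] [r1, r2, r3, r4] 0"
    using cc by blast
  then have "y *\<^sub>R (attraction (r3 - r1) + attraction (r4 - r2)) = y *\<^sub>R (attraction (r4 - r1) + attraction (r3 - r2))"
    unfolding acceleration_four using attraction_minus[of "r2 - r1"] by (simp add: algebra_simps)
  then have "attraction (r3 - r1) + attraction (r4 - r2) = attraction (r4 - r1) + attraction (r3 - r2)" using y by simp
  with d consider "(r3 - r1) + (r4 - r2) = 0"
    | \<alpha> \<beta> where "(r3 - r1) + (r4 - r2) \<noteq> 0"
      "(r4 - r2) - (r3 - r1) = \<alpha> *\<^sub>R ((r3 - r1) + (r4 - r2))"
      "(r3 - r2) - (r4 - r1) = \<beta> *\<^sub>R ((r3 - r1) + (r4 - r2))"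
    using balanced_diagonals_plane[of "r3 - r1" "r4 - r2" "r4 - r1" "r3 - r2"] by (auto simp: algebra_simps)
  then show ?thesis
  proof cases
    case 1
    then show ?thesis by (simp add: algebra_simps)
  next
    case 2
    define p where "p = (r3 - r1) + (r4 - r2)"
    have r: "2 *\<^sub>R (r3 - r1) = (1 - \<alpha>) *\<^sub>R p" "2 *\<^sub>R (r4 - r1) = (1 - \<beta>) *\<^sub>R p" "2 *\<^sub>R (r2 - r1) = (- \<alpha> - \<beta>) *\<^sub>R p"
      unfolding scaleR_diff_left 2(2,3)[folded p_def, symmetric] scaleR_minus_left
      by (simp_all add: p_def scaleR_2 algebra_simps)
    have half: "u = (c / 2) *\<^sub>R p" if "2 *\<^sub>R u = c *\<^sub>R p" for u c
    proof -
      have "(1/2) *\<^sub>R (2 *\<^sub>R u) = (1/2) *\<^sub>R (c *\<^sub>R p)" using that by simp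
      then show ?thesis by simp
    qed
    have "{r1, r2, r3, r4} = (\<lambda>t. r1 + t *\<^sub>R p) ` {0, (- \<alpha> - \<beta>) / 2, (1 - \<alpha>) / 2, (1 - \<beta>) / 2}"
      using half[OF r(1)] half[OF r(2)] half[OF r(3)] by (simp add: diff_eq_eq add.commute)
    then have "collinear {r1, r2, r3, r4}"
      by (simp only: collinear_image_line)
    then show ?thesis using nc by simp
  qed
qed

section \<open>Parallelograms as central configurations\<close>

text \<open>
  Opposite bodies of such a parallelogram automatically have equal accelerations. The two equations are the
  components along \<open>A\<close> and \<open>B\<close> of the equality of the accelerations of bodies 1 and 3.
\<close>

lemma parallelogram_zero_cc_iff:
  fixes o' A B :: "real^2"
  shows "planar_noncollinear_cc 0 [x, - x, y, - y] [o' + A, o' - A, o' + B, o' - B] \<longleftrightarrow>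
    x \<noteq> 0 \<and> y \<noteq> 0 \<and> independent_pair A B \<and>
    2 * x * (1 / norm (2 *\<^sub>R A) ^ 3) = x * (1 / norm (A - B) ^ 3 + 1 / norm (A + B) ^ 3) - y * (1 / norm (A + B) ^ 3 - 1 / norm (A - B) ^ 3) \<and>
    2 * y * (1 / norm (2 *\<^sub>R B) ^ 3) = y * (1 / norm (A - B) ^ 3 + 1 / norm (A + B) ^ 3) - x * (1 / norm (A + B) ^ 3 - 1 / norm (A - B) ^ 3)"
    (is "?cc \<longleftrightarrow> _ \<and> _ \<and> _ \<and> ?E1 \<and> ?E2")
proof (cases "independent_pair A B")
  case False
  then show ?thesis by (simp add: planar_noncollinear_zero_cc_iff collinear_parallelogram_iff)
next
  case True
  have ind: "\<alpha> *\<^sub>R A + \<beta> *\<^sub>R B \<noteq> 0" if "\<alpha> \<noteq> 0 \<or> \<beta> \<noteq> 0" for \<alpha> \<beta>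
    using True that by (auto simp: independent_pair_def)
  have ind_iff: "\<alpha> *\<^sub>R A + \<beta> *\<^sub>R B = 0 \<longleftrightarrow> \<alpha> = 0 \<and> \<beta> = 0" for \<alpha> \<beta>
    using ind[of \<alpha> \<beta>] by auto
  have dist: "distinct [o' + A, o' - A, o' + B, o' - B]"
    using ind[of 2 0] ind[of 0 2] ind[of 1 1] ind[of 1 "-1"]
    by (auto simp: scaleR_2 algebra_simps eq_neg_iff_add_eq_0 neg_eq_iff_add_eq_0)
  let ?r = "[o' + A, o' - A, o' + B, o' - B]" and ?m = "[x, - x, y, - y]"
  define S1 S2 s t where "S1 = 1 / norm (2 *\<^sub>R A) ^ 3" and "S2 = 1 / norm (2 *\<^sub>R B) ^ 3"
    and "s = 1 / norm (A - B) ^ 3" and "t = 1 / norm (A + B) ^ 3"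
  have attraction: "attraction (2 *\<^sub>R A) = (2 * S1) *\<^sub>R A" "attraction (2 *\<^sub>R B) = (2 * S2) *\<^sub>R B" "attraction (A - B) = s *\<^sub>R (A - B)" "attraction (A + B) = t *\<^sub>R (A + B)"
    by (simp_all add: attraction_def S1_def S2_def s_def t_def)
  have d: "(o' - A) - (o' + A) = - (2 *\<^sub>R A)" "(o' + A) - (o' - A) = 2 *\<^sub>R A"
    "(o' - B) - (o' + B) = - (2 *\<^sub>R B)" "(o' + B) - (o' - B) = 2 *\<^sub>R B"
    "(o' + A) - (o' + B) = A - B" "(o' - B) - (o' - A) = A - B"
    "(o' + B) - (o' + A) = - (A - B)" "(o' - A) - (o' - B) = - (A - B)"
    "(o' + B) - (o' - A) = A + B" "(o' + A) - (o' - B) = A + B"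
    "(o' - B) - (o' + A) = - (A + B)" "(o' - A) - (o' + B) = - (A + B)"
    by (simp_all add: scaleR_2)
  have a: "acceleration ?m ?r 0 = (2 * x * S1 - y * s + y * t) *\<^sub>R A + (y * s + y * t) *\<^sub>R B"
    "acceleration ?m ?r 1 = (2 * x * S1 - y * s + y * t) *\<^sub>R A + (y * s + y * t) *\<^sub>R B"
    "acceleration ?m ?r 2 = (x * s + x * t) *\<^sub>R A + (2 * y * S2 - x * s + x * t) *\<^sub>R B"
    "acceleration ?m ?r 3 = (x * s + x * t) *\<^sub>R A + (2 * y * S2 - x * s + x * t) *\<^sub>R B"
    unfolding acceleration_four d attraction_minus attraction by (simp_all add: algebra_simps)
  have "acceleration ?m ?r 2 = acceleration ?m ?r 0 \<longleftrightarrow>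
     ((x * s + x * t) - (2 * x * S1 - y * s + y * t)) *\<^sub>R A + ((2 * y * S2 - x * s + x * t) - (y * s + y * t)) *\<^sub>R B = 0"
    unfolding a by (simp add: algebra_simps)
  also have "\<dots> \<longleftrightarrow> (x * s + x * t) - (2 * x * S1 - y * s + y * t) = 0 \<and> (2 * y * S2 - x * s + x * t) - (y * s + y * t) = 0"
    by (rule ind_iff)
  also have "\<dots> \<longleftrightarrow> ?E1 \<and> ?E2"
    unfolding S1_def[symmetric] S2_def[symmetric] s_def[symmetric] t_def[symmetric] by (auto simp: algebra_simps)
  finally show ?thesis
    using True dist a by (auto simp: planar_noncollinear_zero_cc_iff collinear_parallelogram_iff)
qed

section \<open>The equation for the shape\<close>

text \<open>
  If the inverse cubes of the diagonals are \<open>1 - k e\<close> and \<open>1 - e / k\<close> and those of the sides are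
  \<open>1 - e\<close> and \<open>1 + e\<close>, then \<open>length_defect k e\<close> is the amount by which the squares of the
  lengths violate the parallelogram law.
\<close>

definition length_defect :: "real \<Rightarrow> real \<Rightarrow> real" where
  "length_defect k e = (1 - k * e) powr (-2/3) + (1 - e / k) powr (-2/3)
     - 2 * (1 - e) powr (-2/3) - 2 * (1 + e) powr (-2/3)"

text \<open>
  All four inverse cubes are positive.
\<close>

definition admissible :: "real \<Rightarrow> real \<Rightarrow> bool" where
  "admissible k e \<longleftrightarrow> k * e < 1 \<and> e / k < 1 \<and> \<bar>e\<bar> < 1"

text \<open>
  A form in which all four terms can be differentiated by the same rule.
\<close>

lemma length_defect_linear_factors:
  "length_defect k = (\<lambda>t. (1 + (-k) * t) powr (-2/3) + (1 + (-(1/k)) * t) powr (-2/3)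
     - 2 * (1 + (-1) * t) powr (-2/3) - 2 * (1 + 1 * t) powr (-2/3))"
  by (rule ext) (simp add: length_defect_def)

lemma length_defect_uminus: "length_defect (- k) (- e) = length_defect k e"
  by (simp add: length_defect_def algebra_simps)

lemma admissible_uminus: "admissible (- k) (- e) \<longleftrightarrow> admissible k e"
  by (simp add: admissible_def)

lemma powr_le_one: "x powr (-2/3) \<le> 1" if "1 \<le> x" for x :: real
  using powr_mono2'[of "-2/3" 1 x] that by simp

lemma one_le_powr: "1 \<le> x powr (-2/3)" if "0 < x" "x \<le> 1" for x :: real
  using powr_mono2'[of "-2/3" x 1] that by simp

lemma length_defect_neg:
  assumes "0 < k" "e \<le> 0" "-1 < e"
  shows "length_defect k e < 0"
proof -
  have "k * e \<le> 0" "e / k \<le> 0" using assms by (simp_all add: mult_nonneg_nonpos divide_nonpos_pos)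
  then have "(1 - k * e) powr (-2/3) \<le> 1" "(1 - e / k) powr (-2/3) \<le> 1"
    by (intro powr_le_one; simp)+
  moreover have "1 \<le> (1 + e) powr (-2/3)" using assms by (intro one_le_powr) auto
  moreover have "0 < (1 - e) powr (-2/3)" using assms by simp
  ultimately show ?thesis unfolding length_defect_def by linarith
qed

text \<open>
  This comparison of the diagonals with a side makes the shape equation monotone and its solutions
  non-degenerate. It rests on \<open>k + 1 / k \<ge> 2\<close>.
\<close>

lemma diagonal_product_le:
  fixes k e :: real
  assumes "0 < k" "0 \<le> e"
  shows "(1 - k * e) * (1 - e / k) \<le> (1 - e)\<^sup>2"
proof -
  have "0 \<le> (k - 1)\<^sup>2 / k" using assms by simp
  also have "\<dots> = k + 1 / k - 2" using assms by (simp add: field_simps power2_eq_square)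
  finally have "0 \<le> e * (k + 1 / k - 2)" using assms by simp
  also have "\<dots> = (1 - e)\<^sup>2 - (1 - k * e) * (1 - e / k)"
    using assms by (simp add: field_simps power2_eq_square)
  finally show ?thesis by simp
qed

lemma double_le_sum:
  fixes a b c :: real
  assumes "c\<^sup>2 \<le> a * b" "0 \<le> a" "0 \<le> b"
  shows "2 * c \<le> a + b"
proof (rule power2_le_imp_le)
  have "2 * a * b \<le> a\<^sup>2 + b\<^sup>2" by (rule sum_squares_bound)
  then show "(2 * c)\<^sup>2 \<le> (a + b)\<^sup>2" using assms(1) by (simp add: power2_sum power_mult_distrib)
  show "0 \<le> a + b" using assms by simp
qed

text \<open>
  In the derivative only the term of the side \<open>1 - t\<close> is negative. It is dominated by the two diagonal terms
  \<open>a\<close> and \<open>b\<close>: their geometric mean is already at least \<open>(1 - t) powr (-5/3)\<close> by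
  \<open>diagonal_product_le\<close>.
\<close>

lemma length_defect_strict_mono:
  assumes k: "0 < k" and e: "0 \<le> e" "e < e'" and adm: "admissible k e'"
  shows "length_defect k e < length_defect k e'"
proof (rule DERIV_pos_imp_increasing[OF e(2)], intro exI conjI allI impI)
  fix t assume t: "e \<le> t" "t \<le> e'"
  have "k * t \<le> k * e'" "t / k \<le> e' / k" using t k by (simp_all add: divide_right_mono)
  then have p: "0 < 1 - k * t" "0 < 1 - t / k" "0 < 1 - t" "0 < 1 + t"
    using t e adm by (auto simp: admissible_def)
  let ?D = "2/3 * (k * (1 - k * t) powr (-5/3) + (1 / k) * (1 - t / k) powr (-5/3)
      - 2 * (1 - t) powr (-5/3) + 2 * (1 + t) powr (-5/3))"
  have 1: "((\<lambda>t. (1 + c * t) powr (-2/3)) has_real_derivative - 2/3 * c * (1 + c * t) powr (-5/3)) (at t)"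
    if "0 < 1 + c * t" for c
    using that by (auto intro!: derivative_eq_intros)
  have "((\<lambda>t. (1 + (-k) * t) powr (-2/3) + (1 + (-(1/k)) * t) powr (-2/3)
     - 2 * (1 + (-1) * t) powr (-2/3) - 2 * (1 + 1 * t) powr (-2/3)) has_real_derivative
     (- 2/3 * (-k) * (1 + (-k) * t) powr (-5/3) + - 2/3 * (-(1/k)) * (1 + (-(1/k)) * t) powr (-5/3)
     - 2 * (- 2/3 * (-1) * (1 + (-1) * t) powr (-5/3)) - 2 * (- 2/3 * 1 * (1 + 1 * t) powr (-5/3)))) (at t)"
    by (intro DERIV_diff DERIV_add DERIV_cmult 1) (use p in auto)
  then show "(length_defect k has_real_derivative ?D) (at t)"
    unfolding length_defect_linear_factors by (simp add: algebra_simps)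
  define a b where "a = k * (1 - k * t) powr (-5/3)" and "b = (1 / k) * (1 - t / k) powr (-5/3)"
  have ab: "0 < a" "0 < b" using k p by (simp_all add: a_def b_def)
  have "((1 - t) powr (-5/3))\<^sup>2 = ((1 - t)\<^sup>2) powr (-5/3)"
    using p by (simp add: power2_eq_square powr_mult)
  also have "\<dots> \<le> ((1 - k * t) * (1 - t / k)) powr (-5/3)"
    using p k t e diagonal_product_le[of k t] by (intro powr_mono2') auto
  also have "\<dots> = a * b" using p k by (simp add: a_def b_def powr_mult)
  finally have "((1 - t) powr (-5/3))\<^sup>2 \<le> a * b" .
  then have "2 * (1 - t) powr (-5/3) \<le> a + b" using ab by (intro double_le_sum) auto
  moreover have "0 < (1 + t) powr (-5/3)" using p by simp
  ultimately have "0 < a + b - 2 * (1 - t) powr (-5/3) + 2 * (1 + t) powr (-5/3)" by linarith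
  then show "0 < ?D" by (simp add: a_def b_def)
qed

lemma length_defect_root_sign:
  assumes "k \<noteq> 0" "admissible k e" "length_defect k e = 0"
  shows "0 < k * e"
proof (cases "0 < k")
  case True
  then have "0 < e" using length_defect_neg[of k e] assms by (force simp: admissible_def)
  then show ?thesis using True by simp
next
  case False
  then have "0 < - e" using length_defect_neg[of "- k" "- e"] length_defect_uminus[of k e] assms
    by (force simp: admissible_def)
  then show ?thesis using False assms(1) by (simp add: mult_neg_neg)
qed

text \<open>
  Reversing the signs of \<open>k\<close> and \<open>e\<close> exchanges the two kinds of sides; this reduces everything to positive
  \<open>k\<close>, where both roots are positive and monotonicity applies.
\<close>

lemma length_defect_root_unique:
  assumes "k \<noteq> 0" and e: "admissible k e" "length_defect k e = 0" and e': "admissible k e'" "length_defect k e' = 0"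
  shows "e = e'"
proof -
  have wlog: "e = e'" if "0 < k" and e: "admissible k e" "length_defect k e = 0" and e': "admissible k e'" "length_defect k e' = 0"
    for k e e'
  proof -
    have "0 < e" "0 < e'"
      using length_defect_root_sign[of k e] length_defect_root_sign[of k e'] that by (simp_all add: zero_less_mult_iff)
    then show ?thesis
      using length_defect_strict_mono[of k e e'] length_defect_strict_mono[of k e' e] that by force
  qed
  show ?thesis
  proof (cases "0 < k")
    case True
    then show ?thesis using wlog e e' by blast
  next
    case False
    then have "- e = - e'"
      using wlog[of "- k" "- e" "- e'"] assms by (simp add: admissible_uminus length_defect_uminus)
    then show ?thesis by simp
  qed
qed

lemma length_defect_one_no_root: "admissible 1 e \<Longrightarrow> length_defect 1 e \<noteq> 0"
  by (auto simp: admissible_def length_defect_def)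

text \<open>
  For \<open>k > 1\<close> the function is negative at \<open>0\<close>, and near \<open>1 / k\<close> it is large because the term of the longer
  diagonal is unbounded while the others are bounded. The case \<open>0 < k < 1\<close> follows by exchanging the
  diagonals.
\<close>

lemma length_defect_root_exists:
  assumes "k \<noteq> 0" "\<bar>k\<bar> \<noteq> 1"
  obtains e where "admissible k e" "length_defect k e = 0"
proof -
  have gt: "\<exists>e. admissible k e \<and> length_defect k e = 0" if k: "1 < k" for k
  proof -
    \<comment> \<open>\<open>M\<close> bounds the two side terms, and \<open>t\<close> is chosen so that the term of the first diagonal equals \<open>M\<close>.\<close>
    define M where "M = 2 * (1 - 1 / k) powr (-2/3) + 2"
    define \<epsilon> where "\<epsilon> = M powr (-3/2)"
    define t where "t = (1 - \<epsilon>) / k"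
    have "0 \<le> (1 - 1 / k) powr (-2/3)" by simp
    then have M: "1 < M" unfolding M_def by linarith
    have "M powr (-3/2) < M powr 0" using M by (intro powr_less_mono) auto
    then have \<epsilon>: "0 < \<epsilon>" "\<epsilon> < 1" using M by (simp_all add: \<epsilon>_def)
    have kt: "1 - k * t = \<epsilon>" using k by (simp add: t_def)
    have t: "0 < t" "t < 1 / k" "1 / k < 1" using k \<epsilon> by (simp_all add: t_def divide_strict_right_mono)
    have tk: "t / k < 1" using t k by (smt (verit) divide_less_eq_1_pos)
    have adm: "admissible k s" if "0 \<le> s" "s \<le> t" for s
    proof -
      have "k * s \<le> k * t" "s / k \<le> t / k" using that k by (simp_all add: divide_right_mono)
      then show ?thesis using that t tk kt \<epsilon> by (auto simp: admissible_def)
    qed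
    have M_eq: "\<epsilon> powr (-2/3) = M" using M by (simp add: \<epsilon>_def powr_powr)
    have 1: "(1 - t) powr (-2/3) \<le> (1 - 1 / k) powr (-2/3)" using t by (intro powr_mono2') auto
    have 2: "(1 + t) powr (-2/3) \<le> 1" using t by (intro powr_le_one) auto
    have 3: "0 \<le> (1 - t / k) powr (-2/3)" by (rule powr_ge_zero)
    have "0 \<le> (2 * d + 2) + a - 2 * b - 2 * c" if "b \<le> d" "c \<le> 1" "0 \<le> a" for a b c d :: real
      using that by simp
    from this[OF 1 2 3] have "0 \<le> length_defect k t" unfolding length_defect_def kt M_eq M_def .
    moreover have "length_defect k 0 \<le> 0" unfolding length_defect_def by simp
    moreover have "continuous_on {0..t} (length_defect k)"
    proof -
      have c: "continuous_on {0..t} (\<lambda>s. (1 + c * s) powr (-2/3))"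
        if "\<And>s. s \<in> {0..t} \<Longrightarrow> 0 < 1 + c * s" for c :: real
        by (intro continuous_on_powr continuous_on_add continuous_on_mult continuous_on_const continuous_on_id)
          (use that in force)
      have "0 < 1 + (-k) * s" "0 < 1 + (-(1/k)) * s" "0 < 1 + (-1) * s" "0 < 1 + 1 * s" if "s \<in> {0..t}" for s
        using adm[of s] that unfolding admissible_def by simp_all
      then have "continuous_on {0..t} (\<lambda>s. (1 + (-k) * s) powr (-2/3) + (1 + (-(1/k)) * s) powr (-2/3)
          - 2 * (1 + (-1) * s) powr (-2/3) - 2 * (1 + 1 * s) powr (-2/3))"
        by (intro continuous_on_add continuous_on_diff continuous_on_mult continuous_on_const c)
      then show ?thesis by (simp only: length_defect_linear_factors)
    qed
    ultimately have "\<exists>e\<ge>0. e \<le> t \<and> length_defect k e = 0" using t by (intro IVT') auto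
    then show ?thesis using adm by blast
  qed
  have swap: "admissible (1 / k) e = admissible k e" "length_defect (1 / k) e = length_defect k e" for k e
    by (auto simp: admissible_def length_defect_def mult.commute)
  have pos: "\<exists>e. admissible k e \<and> length_defect k e = 0" if "0 < k" "k \<noteq> 1" for k
  proof (cases "1 < k")
    case False
    then have "1 < 1 / k" using that by (simp add: field_simps)
    from gt[OF this] show ?thesis by (simp only: swap)
  qed (rule gt)
  show ?thesis
  proof (cases "0 < k")
    case True
    then show ?thesis using pos[of k] assms that by auto
  next
    case False
    then obtain e where "admissible (- k) e" "length_defect (- k) e = 0" using pos[of "- k"] assms by auto
    then show ?thesis using that[of "- e"] admissible_uminus[of k "- e"] length_defect_uminus[of k "- e"] by simp
  qed
qed

text \<open>
  The left side is the square of four times the inner product of the half diagonals, the right side the product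
  of the squares of the diagonals. So this is the strict Cauchy-Schwarz inequality needed to realise the
  lengths by a parallelogram that is not flat.
\<close>

lemma length_defect_root_nondegenerate:
  assumes "k \<noteq> 0" "admissible k e" "0 < k * e"
  shows "((1 + e) powr (-2/3) - (1 - e) powr (-2/3))\<^sup>2
    < (1 - k * e) powr (-2/3) * (1 - e / k) powr (-2/3)"
proof -
  have pos: "((1 + e) powr (-2/3) - (1 - e) powr (-2/3))\<^sup>2 < (1 - k * e) powr (-2/3) * (1 - e / k) powr (-2/3)"
    if k: "0 < k" "0 < e" and adm: "admissible k e" for k e
  proof -
    have p: "0 < 1 - k * e" "0 < 1 - e / k" "0 < 1 - e" using adm by (auto simp: admissible_def)
    have "(1 + e) powr (-2/3) < (1 - e) powr (-2/3)" using k p by (intro powr_less_mono2_neg) auto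
    moreover have "0 < (1 + e) powr (-2/3)" using k by simp
    ultimately have "\<bar>(1 + e) powr (-2/3) - (1 - e) powr (-2/3)\<bar> < \<bar>(1 - e) powr (-2/3)\<bar>" by linarith
    then have "((1 + e) powr (-2/3) - (1 - e) powr (-2/3))\<^sup>2 < ((1 - e) powr (-2/3))\<^sup>2"
      by (rule power2_strict_mono)
    also have "\<dots> = ((1 - e)\<^sup>2) powr (-2/3)" using p by (simp add: power2_eq_square powr_mult)
    also have "\<dots> \<le> ((1 - k * e) * (1 - e / k)) powr (-2/3)"
      using p k diagonal_product_le[of k e] by (intro powr_mono2') auto
    also have "\<dots> = (1 - k * e) powr (-2/3) * (1 - e / k) powr (-2/3)" using p by (simp add: powr_mult)
    finally show ?thesis .
  qed
  show ?thesis
  proof (cases "0 < k")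
    case True
    then show ?thesis using pos[of k e] assms by (simp add: zero_less_mult_iff)
  next
    case False
    then have "e < 0" using assms by (simp add: zero_less_mult_iff)
    moreover have "admissible (- k) (- e)" using assms(2) by (simp only: admissible_uminus)
    ultimately have X: "((1 + - e) powr (-2/3) - (1 - - e) powr (-2/3))\<^sup>2
        < (1 - - k * - e) powr (-2/3) * (1 - - e / - k) powr (-2/3)"
      using False assms(1) by (intro pos) auto
    have "1 + - e = 1 - e" "1 - - e = 1 + e" "1 - - k * - e = 1 - k * e" "1 - - e / - k = 1 - e / k" by simp_all
    from X[unfolded this] show ?thesis
      by (simp only: power2_commute[of "(1 + e) powr (-2/3)" "(1 - e) powr (-2/3)"])
  qed
qed

section \<open>The shape of a solution\<close>

lemma parallelogram_law_norm:
  fixes A B :: "'a::real_inner"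
  shows "(norm (2 *\<^sub>R A))\<^sup>2 + (norm (2 *\<^sub>R B))\<^sup>2 = 2 * (norm (A - B))\<^sup>2 + 2 * (norm (A + B))\<^sup>2"
  by (simp add: power2_norm_eq_inner inner_simps algebra_simps inner_commute)

lemma norm_power2_eq_powr:
  assumes "z \<noteq> 0"
  shows "(norm z)\<^sup>2 = (1 / norm z ^ 3) powr (-2/3)"
proof -
  have "1 / norm z ^ 3 = norm z powr (-3)" using assms by (simp add: powr_minus_divide powr_realpow)
  then show ?thesis using assms by (simp add: powr_powr powr_realpow[of "norm z" 2, simplified])
qed

text \<open>
  The number \<open>e\<close> measures the relative difference of the inverse cubes of the sides, and \<open>m\<close> is their
  mean.
\<close>

lemma zero_cc_shape:
  fixes o' A B :: "real^2"
  assumes "planar_noncollinear_cc 0 [x, - x, y, - y] [o' + A, o' - A, o' + B, o' - B]"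
  obtains m e where "0 < m" "admissible (y / x) e" "length_defect (y / x) e = 0"
    "1 / norm (2 *\<^sub>R A) ^ 3 = m * (1 - (y / x) * e)" "1 / norm (2 *\<^sub>R B) ^ 3 = m * (1 - e / (y / x))"
    "1 / norm (A - B) ^ 3 = m * (1 - e)" "1 / norm (A + B) ^ 3 = m * (1 + e)"
proof -
  note cc = assms[unfolded parallelogram_zero_cc_iff]
  have xy: "x \<noteq> 0" "y \<noteq> 0" and ind: "independent_pair A B" using cc by auto
  have nz: "2 *\<^sub>R A \<noteq> 0" "2 *\<^sub>R B \<noteq> 0" "A - B \<noteq> 0" "A + B \<noteq> 0"
    using ind unfolding independent_pair_def
    by (auto dest: spec2[of _ 1 0] spec2[of _ 0 1] spec2[of _ 1 "-1"] spec2[of _ 1 1])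
  define S1 S2 s t where "S1 = 1 / norm (2 *\<^sub>R A) ^ 3" and "S2 = 1 / norm (2 *\<^sub>R B) ^ 3"
    and "s = 1 / norm (A - B) ^ 3" and "t = 1 / norm (A + B) ^ 3"
  have pos: "0 < S1" "0 < S2" "0 < s" "0 < t" using nz by (simp_all add: S1_def S2_def s_def t_def)
  have E: "2 * x * S1 = x * (s + t) - y * (t - s)" "2 * y * S2 = y * (s + t) - x * (t - s)"
    using cc by (simp_all add: S1_def S2_def s_def t_def)
  \<comment> \<open>With these unknowns the two equations are solved for the diagonals.\<close>
  define m e where "m = (s + t) / 2" and "e = (t - s) / (s + t)"
  have m: "0 < m" using pos by (simp add: m_def)
  have "s + t \<noteq> 0" using pos by linarith
  moreover have "q / 2 * (d / q) = d / 2" if "q \<noteq> 0" for q d :: real using that by simp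
  ultimately have me: "m * e = (t - s) / 2" unfolding m_def e_def by blast
  have st: "s = m * (1 - e)" "t = m * (1 + e)" unfolding right_diff_distrib distrib_left me by (simp_all add: m_def field_simps)
  have "S1 = m - (y / x) * (m * e)" using E(1) xy unfolding me by (simp add: m_def field_simps)
  then have S1: "S1 = m * (1 - (y / x) * e)" by (simp add: algebra_simps)
  have "S2 = m - (x / y) * (m * e)" using E(2) xy unfolding me by (simp add: m_def field_simps)
  then have S2: "S2 = m * (1 - e / (y / x))" by (simp add: algebra_simps)
  have p: "0 < 1 - e" "0 < 1 + e" "0 < 1 - (y / x) * e" "0 < 1 - e / (y / x)"
    using pos m unfolding st S1 S2 by (simp_all only: zero_less_mult_pos)
  then have adm: "admissible (y / x) e" by (auto simp: admissible_def)
  have law: "S1 powr (-2/3) + S2 powr (-2/3) = 2 * s powr (-2/3) + 2 * t powr (-2/3)"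
    using parallelogram_law_norm[of A B] unfolding norm_power2_eq_powr[OF nz(1)] norm_power2_eq_powr[OF nz(2)]
      norm_power2_eq_powr[OF nz(3)] norm_power2_eq_powr[OF nz(4)] S1_def S2_def s_def t_def .
  have prod: "(m * w) powr (-2/3) = m powr (-2/3) * w powr (-2/3)" if "0 < w" for w
    using m that by (simp add: powr_mult)
  have factor: "c * (a + b - 2 * a' - 2 * b') = 0" if "c * a + c * b = 2 * (c * a') + 2 * (c * b')"
    for a b a' b' c :: real using that by (simp add: algebra_simps)
  have "m powr (-2/3) * length_defect (y / x) e = 0"
    unfolding length_defect_def
    by (rule factor[OF law[unfolded st S1 S2 prod[OF p(1)] prod[OF p(2)] prod[OF p(3)] prod[OF p(4)]]])
  then have "length_defect (y / x) e = 0" using m by simp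
  from that[OF m adm this] show ?thesis using S1 S2 st unfolding S1_def S2_def s_def t_def by blast
qed

lemma center_form:
  fixes r1 :: "real^2"
  assumes "r1 + r2 = r3 + r4"
  obtains o' A B where "r1 = o' + A" "r2 = o' - A" "r3 = o' + B" "r4 = o' - B"
proof
  let ?o = "(1/2) *\<^sub>R (r1 + r2)"
  have h: "(1/2) *\<^sub>R v + (1/2) *\<^sub>R v = v" for v :: "real^2" by (simp add: scaleR_half_double[symmetric] flip: scaleR_add_left)
  have "?o + ?o = r1 + r2" by (rule h)
  show "r1 = ?o + (r1 - ?o)" "r2 = ?o - (r1 - ?o)" "r3 = ?o + (r3 - ?o)" "r4 = ?o - (r3 - ?o)"
    using \<open>?o + ?o = r1 + r2\<close> assms by (simp_all add: algebra_simps)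
qed

lemma norm_less_of_inverse_cube_less:
  fixes a b :: "'a::real_normed_vector"
  assumes "1 / norm a ^ 3 < 1 / norm b ^ 3" "a \<noteq> 0"
  shows "norm b < norm a"
proof (rule ccontr)
  assume "\<not> norm b < norm a"
  then have "1 / norm b ^ 3 \<le> 1 / norm a ^ 3"
    using assms(2) by (intro divide_left_mono power_mono mult_pos_pos) auto
  then show False using assms(1) by simp
qed

lemma same_norm_ratio:
  fixes a :: "'a::real_normed_vector" and b :: "'b::real_normed_vector"
  assumes "1 / norm a ^ 3 = m * w" "1 / norm b ^ 3 = m' * w" "0 < m" "0 < m'" "a \<noteq> 0" "b \<noteq> 0"
  shows "norm b = root 3 (m / m') * norm a"
proof -
  have "w \<noteq> 0" using assms(1,5) by auto
  have "norm b ^ 3 = 1 / (m' * w)" "norm a ^ 3 = 1 / (m * w)"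
    unfolding assms(1,2)[symmetric] by simp_all
  moreover have "1 / (m' * w) = (m / m') * (1 / (m * w))" using assms(3,4) \<open>w \<noteq> 0\<close> by simp
  ultimately have "norm b ^ 3 = (m / m') * norm a ^ 3" by (simp only:)
  also have "\<dots> = (root 3 (m / m') * norm a) ^ 3"
    using assms(3,4) by (simp only: power_mult_distrib real_root_pow_pos2 divide_nonneg_pos less_imp_le zero_less_numeral)
  finally show ?thesis
    by (rule power_eq_imp_eq_base) (use assms(3,4) in simp_all)
qed

section \<open>Uniqueness up to similarity\<close>

lemma orthogonal_transformation_of_pair:
  fixes A B A' B' :: "real^2"
  assumes ind: "independent_pair A B" and n: "norm A' = norm A" "norm B' = norm B" "A' \<bullet> B' = A \<bullet> B"
  obtains T where "orthogonal_transformation T" "T A = A'" "T B = B'"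
proof -
  have AB: "A \<noteq> B" "A \<noteq> 0" "B \<noteq> 0"
    using ind unfolding independent_pair_def
    by (auto dest: spec2[of _ 1 0] spec2[of _ 0 1] spec2[of _ 1 "-1"])
  have i: "independent {A, B}"
  proof (rule independent_if_scalars_zero)
    fix f x assume 0: "(\<Sum>x\<in>{A, B}. f x *\<^sub>R x) = 0" and x: "x \<in> {A, B}"
    then have "f A *\<^sub>R A + f B *\<^sub>R B = 0" using AB by simp
    then have "f A = 0" "f B = 0" using ind unfolding independent_pair_def by blast+
    then show "f x = 0" using x by auto
  qed simp
  obtain T where T: "linear T" "\<forall>x\<in>{A, B}. T x = (\<lambda>x. if x = A then A' else B') x"
    using linear_independent_extend[OF i, of "\<lambda>x. if x = A then A' else B'"] by blast
  then have TA: "T A = A'" "T B = B'" using AB by auto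
  have "dim (UNIV :: (real^2) set) \<le> card {A, B}" using AB(1) by simp
  then have span: "UNIV \<subseteq> span {A, B}" by (intro card_ge_dim_independent i subset_UNIV)
  have sp: "\<exists>\<alpha> \<beta>. v = \<alpha> *\<^sub>R A + \<beta> *\<^sub>R B" for v
  proof -
    have "v \<in> span {A, B}" using span by blast
    then obtain \<alpha> \<beta> where "v - \<alpha> *\<^sub>R A = \<beta> *\<^sub>R B" unfolding span_breakdown_eq span_singleton by blast
    then show ?thesis by (metis add.commute diff_eq_eq)
  qed
  have "norm (T v) = norm v" for v
  proof -
    obtain \<alpha> \<beta> where v: "v = \<alpha> *\<^sub>R A + \<beta> *\<^sub>R B" using sp by blast
    have "T v = \<alpha> *\<^sub>R A' + \<beta> *\<^sub>R B'" unfolding v by (simp add: linear_add[OF T(1)] linear_scale[OF T(1)] TA)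
    moreover have "A' \<bullet> A' = A \<bullet> A" "B' \<bullet> B' = B \<bullet> B" using n(1,2) by (simp_all add: norm_eq)
    moreover have "(\<alpha> *\<^sub>R X + \<beta> *\<^sub>R Y) \<bullet> (\<alpha> *\<^sub>R X + \<beta> *\<^sub>R Y)
        = \<alpha>\<^sup>2 * (X \<bullet> X) + 2 * \<alpha> * \<beta> * (X \<bullet> Y) + \<beta>\<^sup>2 * (Y \<bullet> Y)" for X Y :: "real^2"
      by (simp add: inner_add_left inner_add_right inner_commute[of Y X] algebra_simps power2_eq_square)
    ultimately have "T v \<bullet> T v = v \<bullet> v" using n(3) by (simp only: v)
    then show ?thesis by (simp add: norm_eq)
  qed
  then have "orthogonal_transformation T" using T(1) by (simp add: orthogonal_transformation)
  then show ?thesis using that TA by blast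
qed

text \<open>
  Both configurations have the same \<open>e\<close>, hence proportional diagonals and sides. By polarization the inner
  products of their half diagonals are proportional too, and an orthogonal map carries one frame to
  the other.
\<close>

lemma zero_cc_unique:
  fixes o' A B p' A' B' :: "real^2"
  assumes cc: "planar_noncollinear_cc 0 [x, - x, y, - y] [o' + A, o' - A, o' + B, o' - B]"
    and cc': "planar_noncollinear_cc 0 [x, - x, y, - y] [p' + A', p' - A', p' + B', p' - B']"
  shows "same_up_to_similarity [o' + A, o' - A, o' + B, o' - B] [p' + A', p' - A', p' + B', p' - B']"
proof -
  have k: "y / x \<noteq> 0" and ind: "independent_pair A B" "independent_pair A' B'"
    using cc cc' by (auto simp: parallelogram_zero_cc_iff)
  obtain m e where m: "0 < m" "admissible (y / x) e" "length_defect (y / x) e = 0"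
    "1 / norm (2 *\<^sub>R A) ^ 3 = m * (1 - (y / x) * e)" "1 / norm (2 *\<^sub>R B) ^ 3 = m * (1 - e / (y / x))"
    "1 / norm (A - B) ^ 3 = m * (1 - e)" "1 / norm (A + B) ^ 3 = m * (1 + e)" using zero_cc_shape[OF cc] .
  obtain m' e' where m': "0 < m'" "admissible (y / x) e'" "length_defect (y / x) e' = 0"
    "1 / norm (2 *\<^sub>R A') ^ 3 = m' * (1 - (y / x) * e')" "1 / norm (2 *\<^sub>R B') ^ 3 = m' * (1 - e' / (y / x))"
    "1 / norm (A' - B') ^ 3 = m' * (1 - e')" "1 / norm (A' + B') ^ 3 = m' * (1 + e')" using zero_cc_shape[OF cc'] .
  have e: "e' = e" using length_defect_root_unique[OF k m'(2,3) m(2,3)] .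
  define c where "c = root 3 (m / m')"
  have c: "0 < c" using m(1) m'(1) by (simp add: c_def)
  have nz: "2 *\<^sub>R A \<noteq> 0" "2 *\<^sub>R B \<noteq> 0" "A - B \<noteq> 0" "A + B \<noteq> 0" if "independent_pair A B" for A B :: "real^2"
    using that unfolding independent_pair_def
    by (auto dest: spec2[of _ 1 0] spec2[of _ 0 1] spec2[of _ 1 "-1"] spec2[of _ 1 1])
  note nz1 = nz[OF ind(1)] and nz2 = nz[OF ind(2)]
  note m'' = m'(4-7)[unfolded e]
  have "norm (2 *\<^sub>R A') = c * norm (2 *\<^sub>R A)" unfolding c_def
    by (rule same_norm_ratio[OF m(4) m''(1) m(1) m'(1) nz1(1) nz2(1)])
  moreover have "norm (2 *\<^sub>R B') = c * norm (2 *\<^sub>R B)" unfolding c_def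
    by (rule same_norm_ratio[OF m(5) m''(2) m(1) m'(1) nz1(2) nz2(2)])
  moreover have pm: "norm (A' - B') = c * norm (A - B)" "norm (A' + B') = c * norm (A + B)" unfolding c_def
    by (rule same_norm_ratio[OF m(6) m''(3) m(1) m'(1) nz1(3) nz2(3)],
        rule same_norm_ratio[OF m(7) m''(4) m(1) m'(1) nz1(4) nz2(4)])
  ultimately have n: "norm ((1 / c) *\<^sub>R A') = norm A" "norm ((1 / c) *\<^sub>R B') = norm B" using c by simp_all
  have dot: "4 * (u \<bullet> v) = (norm (u + v))\<^sup>2 - (norm (u - v))\<^sup>2" for u v :: "real^2"
    by (simp add: power2_norm_eq_inner inner_simps inner_commute)
  have "4 * (A' \<bullet> B') = c\<^sup>2 * (4 * (A \<bullet> B))"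
    unfolding dot pm by (simp add: power_mult_distrib algebra_simps)
  then have "(1 / c) *\<^sub>R A' \<bullet> (1 / c) *\<^sub>R B' = A \<bullet> B" using c by (simp add: field_simps power2_eq_square)
  from orthogonal_transformation_of_pair[OF ind(1) n this]
  obtain T where T: "orthogonal_transformation T" "T A = (1 / c) *\<^sub>R A'" "T B = (1 / c) *\<^sub>R B'" by blast
  define f where "f = (\<lambda>v. c *\<^sub>R T v + (p' - c *\<^sub>R T o'))"
  have "plane_similarity f"
    unfolding plane_similarity_def f_def using T(1) c by (intro exI[of _ T] exI[of _ c] exI[of _ "p' - c *\<^sub>R T o'"] conjI refl) simp_all
  moreover
  have "linear T" using T(1) by (simp add: orthogonal_transformation)
  then have lin: "T (u + v) = T u + T v" "T (u - v) = T u - T v" for u v by (simp_all add: linear_add linear_diff)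
  have cancel: "a + b + (p - a) = p + b" "a - b + (p - a) = p - b" for a b p :: "real^2" by simp_all
  have plus: "f (o' + w) = p' + c *\<^sub>R T w" for w
    unfolding f_def lin scaleR_add_right by (rule cancel)
  have minus: "f (o' - w) = p' - c *\<^sub>R T w" for w
    unfolding f_def lin scaleR_diff_right by (rule cancel)
  have "c *\<^sub>R T A = A'" "c *\<^sub>R T B = B'" using c unfolding T(2,3) by simp_all
  then have "[p' + A', p' - A', p' + B', p' - B'] = map f [o' + A, o' - A, o' + B, o' - B]"
    by (simp only: list.map plus minus)
  ultimately show ?thesis unfolding same_up_to_similarity_def by (intro exI[of _ f] conjI)
qed

section \<open>Existence\<close>

lemma inverse_cube_of_norm:
  assumes "(norm z)\<^sup>2 = w powr (-2/3)" "0 < w"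
  shows "1 / norm z ^ 3 = w"
proof -
  have "z \<noteq> 0" using assms by auto
  then have "(1 / norm z ^ 3) powr (-2/3) = w powr (-2/3)" using norm_power2_eq_powr[of z] assms by simp
  then have "((1 / norm z ^ 3) powr (-2/3)) powr (-3/2) = (w powr (-2/3)) powr (-3/2)" by simp
  then show ?thesis using assms(2) by (simp add: powr_powr)
qed

text \<open>
  The squared half diagonals \<open>a2, b2\<close> and their inner product \<open>c\<close> are prescribed by the root \<open>e\<close>;
  \<open>A\<close> is placed on the first axis.
\<close>

lemma zero_cc_exists:
  fixes x y :: real
  assumes xy: "x \<noteq> 0" "y \<noteq> 0" "x \<noteq> y" "x \<noteq> - y"
  shows "\<exists>rs. planar_noncollinear_cc 0 [x, - x, y, - y] rs"
proof -
  define k where "k = y / x"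
  have k: "k \<noteq> 0" "\<bar>k\<bar> \<noteq> 1" using xy by (auto simp: k_def abs_if field_simps split: if_splits)
  obtain e where e: "admissible k e" "length_defect k e = 0" using length_defect_root_exists[OF k] .
  have ke: "0 < k * e" using length_defect_root_sign[OF k(1) e] .
  define a2 b2 c where "a2 = (1 - k * e) powr (-2/3) / 4" and "b2 = (1 - e / k) powr (-2/3) / 4"
    and "c = ((1 + e) powr (-2/3) - (1 - e) powr (-2/3)) / 4"
  have w: "0 < 1 - k * e" "0 < 1 - e / k" "0 < 1 - e" "0 < 1 + e" using e(1) by (auto simp: admissible_def)
  have ab: "0 < a2" "c\<^sup>2 < a2 * b2"
    using w length_defect_root_nondegenerate[OF k(1) e(1) ke] by (simp_all add: a2_def b2_def c_def power_divide)
  define A B :: "real^2" where "A = vector [sqrt a2, 0]" and "B = vector [c / sqrt a2, sqrt (b2 - c\<^sup>2 / a2)]"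
  have d: "0 < b2 - c\<^sup>2 / a2" using ab by (simp add: field_simps)
  have n: "A \<bullet> A = a2" "B \<bullet> B = b2" "A \<bullet> B = c"
    using ab d by (simp_all add: A_def B_def inner_vec_def sum_2 power2_eq_square[symmetric] power_divide)
  have ind: "independent_pair A B"
    using ab d by (auto simp: independent_pair_def A_def B_def vec_eq_iff forall_2)
  have sum: "a2 + b2 = ((1 - e) powr (-2/3) + (1 + e) powr (-2/3)) / 2"
    using e(2) by (simp add: length_defect_def a2_def b2_def)
  have "(norm (2 *\<^sub>R A))\<^sup>2 = (1 - k * e) powr (-2/3)" "(norm (2 *\<^sub>R B))\<^sup>2 = (1 - e / k) powr (-2/3)"
    by (simp_all add: power2_norm_eq_inner n a2_def b2_def)
  moreover have "(norm (A - B))\<^sup>2 = (1 - e) powr (-2/3)" "(norm (A + B))\<^sup>2 = (1 + e) powr (-2/3)"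
    using sum by (simp_all add: power2_norm_eq_inner inner_simps n inner_commute[of B A] c_def field_simps)
  ultimately have S: "1 / norm (2 *\<^sub>R A) ^ 3 = 1 - k * e" "1 / norm (2 *\<^sub>R B) ^ 3 = 1 - e / k"
    "1 / norm (A - B) ^ 3 = 1 - e" "1 / norm (A + B) ^ 3 = 1 + e"
    using w by (simp_all only: inverse_cube_of_norm)
  have "planar_noncollinear_cc 0 [x, - x, y, - y] [0 + A, 0 - A, 0 + B, 0 - B]"
    unfolding parallelogram_zero_cc_iff S using xy ind by (simp add: k_def field_simps)
  then show ?thesis by blast
qed

section \<open>Description of all solutions\<close>

lemma four_bodies:
  assumes "planar_noncollinear_cc \<xi> [m1, m2, m3, m4] rs"
  obtains r1 r2 r3 r4 where "rs = [r1, r2, r3, r4]"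
proof -
  have "length rs = Suc (Suc (Suc (Suc 0)))" using assms by (simp add: planar_noncollinear_cc_def central_configuration_def)
  then show ?thesis using that by (auto simp: length_Suc_conv)
qed

lemma zero_cc_centered:
  assumes "planar_noncollinear_cc 0 [x, - x, y, - y] rs"
  obtains o' A B where "rs = [o' + A, o' - A, o' + B, o' - B]"
    "planar_noncollinear_cc 0 [x, - x, y, - y] [o' + A, o' - A, o' + B, o' - B]"
proof -
  obtain r1 r2 r3 r4 where rs: "rs = [r1, r2, r3, r4]" using four_bodies[OF assms] .
  then have "r1 + r2 = r3 + r4" using zero_cc_is_parallelogram assms by blast
  then show ?thesis using center_form[of r1 r2 r3 r4] that assms rs by metis
qed

text \<open>
  Since \<open>k e > 0\<close>, the comparison of \<open>k e\<close> with \<open>e / k\<close> is that of \<open>|k|\<close> with 1, which decides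
  between the diagonals, and the sign of \<open>e\<close> is that of \<open>k\<close>, which decides between the sides.
\<close>

lemma zero_cc_geometry:
  assumes xy: "x \<noteq> 0" "y \<noteq> 0"
    and cc: "planar_noncollinear_cc 0 [x, - x, y, - y] [r1, r2, r3, r4]"
  shows "parallelogram r1 r3 r2 r4"
    "\<bar>x\<bar> < \<bar>y\<bar> \<Longrightarrow> dist r3 r4 < dist r1 r2"
    "\<bar>y\<bar> < \<bar>x\<bar> \<Longrightarrow> dist r1 r2 < dist r3 r4"
    "sgn x = sgn y \<Longrightarrow> a \<in> {dist r1 r3, dist r2 r4} \<Longrightarrow> b \<in> {dist r1 r4, dist r2 r3} \<Longrightarrow> b < a"
    "sgn x = sgn (- y) \<Longrightarrow> a \<in> {dist r1 r4, dist r2 r3} \<Longrightarrow> b \<in> {dist r1 r3, dist r2 r4} \<Longrightarrow> b < a"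
proof -
  have sum: "r1 + r2 = r3 + r4" by (rule zero_cc_is_parallelogram[OF cc])
  have "\<not> collinear {r1, r2, r3, r4}" using cc by (simp add: planar_noncollinear_zero_cc_iff)
  moreover have "{r1, r3, r2, r4} = {r1, r2, r3, r4}" by auto
  ultimately show "parallelogram r1 r3 r2 r4"
    unfolding parallelogram_def using sum by (simp add: algebra_simps)
  obtain o' A B where r: "r1 = o' + A" "r2 = o' - A" "r3 = o' + B" "r4 = o' - B"
    using center_form[OF sum] .
  define k where "k = y / x"
  have k: "k \<noteq> 0" using xy by (simp add: k_def)
  obtain m e where m: "0 < m" "admissible k e" "length_defect k e = 0"
    "1 / norm (2 *\<^sub>R A) ^ 3 = m * (1 - k * e)" "1 / norm (2 *\<^sub>R B) ^ 3 = m * (1 - e / k)"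
    "1 / norm (A - B) ^ 3 = m * (1 - e)" "1 / norm (A + B) ^ 3 = m * (1 + e)"
    using zero_cc_shape[OF cc[unfolded r]] unfolding k_def .
  have "0 < k * e" by (rule length_defect_root_sign[OF k m(2,3)])
  have ind: "independent_pair A B" using cc unfolding r by (simp add: parallelogram_zero_cc_iff)
  have nz: "2 *\<^sub>R A \<noteq> 0" "2 *\<^sub>R B \<noteq> 0" "A - B \<noteq> 0" "A + B \<noteq> 0"
    using ind unfolding independent_pair_def
    by (auto dest: spec2[of _ 1 0] spec2[of _ 0 1] spec2[of _ 1 "-1"] spec2[of _ 1 1])
  have d: "dist r1 r2 = norm (2 *\<^sub>R A)" "dist r3 r4 = norm (2 *\<^sub>R B)" "dist r1 r3 = norm (A - B)"
    "dist r2 r4 = norm (A - B)" "dist r1 r4 = norm (A + B)" "dist r2 r3 = norm (A + B)"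
    by (simp_all only: dist_norm r add_diff_cancel_left)
       (simp_all add: scaleR_2 norm_minus_commute algebra_simps)
  have quot: "e / k = (k * e) / k\<^sup>2" using k by (simp add: power2_eq_square)
  {
    assume "\<bar>x\<bar> < \<bar>y\<bar>"
    then have "1 < \<bar>k\<bar>" using xy by (simp add: k_def abs_divide)
    then have "1 < k\<^sup>2" by (simp add: abs_square_less_1 flip: not_le abs_square_le_1)
    then have "k * e * 1 < k * e * k\<^sup>2" using \<open>0 < k * e\<close> by (intro mult_strict_left_mono)
    then have "e / k < k * e" unfolding quot using k by (simp add: divide_less_eq)
    then have "1 / norm (2 *\<^sub>R A) ^ 3 < 1 / norm (2 *\<^sub>R B) ^ 3" unfolding m using m(1) by simp
    then show "dist r3 r4 < dist r1 r2" unfolding d using nz(1) by (rule norm_less_of_inverse_cube_less)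
  }
  {
    assume "\<bar>y\<bar> < \<bar>x\<bar>"
    then have "\<bar>k\<bar> < 1" using xy by (simp add: k_def abs_divide)
    then have "k\<^sup>2 < 1" by (simp add: abs_square_less_1)
    then have "k * e * k\<^sup>2 < k * e * 1" using \<open>0 < k * e\<close> by (intro mult_strict_left_mono)
    then have "k * e < e / k" unfolding quot using k by (simp add: less_divide_eq)
    then have "1 / norm (2 *\<^sub>R B) ^ 3 < 1 / norm (2 *\<^sub>R A) ^ 3" unfolding m using m(1) by simp
    then show "dist r1 r2 < dist r3 r4" unfolding d using nz(2) by (rule norm_less_of_inverse_cube_less)
  }
  {
    assume "sgn x = sgn y" and ab: "a \<in> {dist r1 r3, dist r2 r4}" "b \<in> {dist r1 r4, dist r2 r3}"
    then have "0 < k" using xy by (auto simp: k_def sgn_if zero_less_divide_iff split: if_splits)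
    then have "0 < e" using \<open>0 < k * e\<close> by (simp add: zero_less_mult_iff)
    then have "1 / norm (A - B) ^ 3 < 1 / norm (A + B) ^ 3" unfolding m using m(1) by simp
    then have "norm (A + B) < norm (A - B)" using nz(3) by (rule norm_less_of_inverse_cube_less)
    then show "b < a" using ab unfolding d by simp
  }
  {
    assume "sgn x = sgn (- y)" and ab: "a \<in> {dist r1 r4, dist r2 r3}" "b \<in> {dist r1 r3, dist r2 r4}"
    then have "k < 0" using xy by (auto simp: k_def sgn_if divide_less_0_iff split: if_splits)
    then have "e < 0" using \<open>0 < k * e\<close> by (simp add: zero_less_mult_iff)
    then have "1 / norm (A + B) ^ 3 < 1 / norm (A - B) ^ 3" unfolding m using m(1) by simp
    then have "norm (A - B) < norm (A + B)" using nz(4) by (rule norm_less_of_inverse_cube_less)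
    then show "b < a" using ab unfolding d by simp
  }
qed

theorem theorem1:
  shows
    "(\<forall>x::real. x \<noteq> 0 \<longrightarrow>
        \<not> (\<exists>rs. planar_noncollinear_cc 0 [x, -x, x, -x] rs))
   \<and>
     (\<forall>x y::real. x \<noteq> 0 \<and> y \<noteq> 0 \<and> x \<noteq> y \<and> x \<noteq> -y \<longrightarrow>
        (\<exists>rs. planar_noncollinear_cc 0 [x, -x, y, -y] rs) \<and>
        (\<forall>rs rs'. planar_noncollinear_cc 0 [x, -x, y, -y] rs \<and>
                  planar_noncollinear_cc 0 [x, -x, y, -y] rs' \<longrightarrow>
                  same_up_to_similarity rs rs') \<and>
        (\<forall>r1 r2 r3 r4. planar_noncollinear_cc 0 [x, -x, y, -y] [r1, r2, r3, r4] \<longrightarrow>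
            parallelogram r1 r3 r2 r4 \<and>
            (\<bar>x\<bar> < \<bar>y\<bar> \<longrightarrow> dist r1 r2 > dist r3 r4) \<and>
            (\<bar>y\<bar> < \<bar>x\<bar> \<longrightarrow> dist r3 r4 > dist r1 r2) \<and>
            (sgn x = sgn y \<longrightarrow>
               (\<forall>a\<in>{dist r1 r3, dist r2 r4}. \<forall>b\<in>{dist r1 r4, dist r2 r3}. a > b)) \<and>
            (sgn x = sgn (-y) \<longrightarrow>
               (\<forall>a\<in>{dist r1 r4, dist r2 r3}. \<forall>b\<in>{dist r1 r3, dist r2 r4}. a > b))))"
proof (rule conjI, goal_cases)
  case 1
  show ?case
  proof (intro allI impI notI, elim exE)
    fix x :: real and rs
    assume x: "x \<noteq> 0" and "planar_noncollinear_cc 0 [x, - x, x, - x] rs"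
    then obtain o' A B where "planar_noncollinear_cc 0 [x, - x, x, - x] [o' + A, o' - A, o' + B, o' - B]"
      using zero_cc_centered by metis
    from zero_cc_shape[OF this] obtain e where "admissible (x / x) e" "length_defect (x / x) e = 0" by metis
    then show False using length_defect_one_no_root[of e] x by simp
  qed
next
  case 2
  show ?case
  proof (intro allI impI, elim conjE, intro conjI)
    fix x y :: real
    assume xy: "x \<noteq> 0" "y \<noteq> 0" "x \<noteq> y" "x \<noteq> - y"
    show "\<exists>rs. planar_noncollinear_cc 0 [x, - x, y, - y] rs" by (rule zero_cc_exists[OF xy])
    show "\<forall>rs rs'. planar_noncollinear_cc 0 [x, - x, y, - y] rs \<and>
        planar_noncollinear_cc 0 [x, - x, y, - y] rs' \<longrightarrow> same_up_to_similarity rs rs'"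
    proof (intro allI impI, elim conjE)
      fix rs rs'
      assume cc: "planar_noncollinear_cc 0 [x, - x, y, - y] rs"
        and cc': "planar_noncollinear_cc 0 [x, - x, y, - y] rs'"
      show "same_up_to_similarity rs rs'"
        by (rule zero_cc_centered[OF cc], rule zero_cc_centered[OF cc']) (metis zero_cc_unique)
    qed
    show "\<forall>r1 r2 r3 r4. planar_noncollinear_cc 0 [x, -x, y, -y] [r1, r2, r3, r4] \<longrightarrow>
            parallelogram r1 r3 r2 r4 \<and>
            (\<bar>x\<bar> < \<bar>y\<bar> \<longrightarrow> dist r1 r2 > dist r3 r4) \<and>
            (\<bar>y\<bar> < \<bar>x\<bar> \<longrightarrow> dist r3 r4 > dist r1 r2) \<and>
            (sgn x = sgn y \<longrightarrow>
               (\<forall>a\<in>{dist r1 r3, dist r2 r4}. \<forall>b\<in>{dist r1 r4, dist r2 r3}. a > b)) \<and>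
            (sgn x = sgn (-y) \<longrightarrow>
               (\<forall>a\<in>{dist r1 r4, dist r2 r3}. \<forall>b\<in>{dist r1 r3, dist r2 r4}. a > b))"
      by (intro allI impI conjI ballI) (erule zero_cc_geometry[OF xy(1,2)]; assumption)+
  qed
qed

end
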